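(* Let $q$ be a prime power, let $\varphi$ be a field automorphism of $\mathbb F_q$, and let $\mathcal F$ be an intersecting family in the Minkowski plane $\mathrm{CM}(2,q,\varphi)$. Then $|\mathcal F|\le q(q-1)$, with equality if and only if $\mathcal F$ consists of all circles through a fixed point.
   Context: For $M\in\mathrm{PGL}(2,q)$ define the map $f_M$ on $\mathrm{PG}(1,q)$ by $f_M(x)=Mx$ if $M\in\mathrm{PSL}(2,q)$ and $f_M(x)=Mx^\varphi$ otherwise ($\varphi$ applied coordinatewise). The Minkowski plane $\mathrm{CM}(2,q,\varphi)$ has point set $\mathrm{PG}(1,q)\times\mathrm{PG}(1,q)$, and its circles are the graphs $\{(x,f_M(x)) : x\in\mathrm{PG}(1,q)\}$ with $M\in\mathrm{PGL}(2,q)$. An intersecting family is a set of circles any two of which have non-empty intersection. *)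

theory Defs
  imports "HOL-Analysis.Determinants" "HOL-Algebra.Coset" "HOL-Number_Theory.Prime_Powers"
begin

definition field_automorphism :: "('a::field \<Rightarrow> 'a) \<Rightarrow> bool" where
  "field_automorphism \<phi> \<longleftrightarrow> bij \<phi> \<and> \<phi> 1 = 1 \<and>
     (\<forall>x y. \<phi> (x + y) = \<phi> x + \<phi> y) \<and> (\<forall>x y. \<phi> (x * y) = \<phi> x * \<phi> y)"

type_synonym 'a proj_point = "('a ^ 2) set"

definition PG1 :: "'a::field proj_point set" where
  "PG1 = {L. vec.subspace L \<and> vec.dim L = 1}"

definition GL2 :: "('a::field ^ 2 ^ 2) monoid" where
  "GL2 = \<lparr>carrier = {A. invertible A}, mult = (**), one = mat 1\<rparr>"

definition SL2 :: "('a::field ^ 2 ^ 2) set" where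
  "SL2 = {A. det A = 1}"

definition scalars2 :: "('a::field ^ 2 ^ 2) set" where
  "scalars2 = {mat c |c. c \<noteq> 0}"

definition PGL2 :: "('a::field ^ 2 ^ 2) set monoid" where
  "PGL2 = GL2 Mod scalars2"

text \<open>\<open>PSL(2,q)\<close> is taken as a subgroup of \<open>PGL(2,q)\<close>, namely the image of \<open>SL(2,q)\<close>.\<close>

definition PSL2 :: "('a::field ^ 2 ^ 2) set set" where
  "PSL2 = (\<lambda>A. scalars2 #>\<^bsub>GL2\<^esub> A) ` SL2"

text \<open>An element of \<open>PGL(2,q)\<close> is a coset of matrices. All its representatives map the line \<open>x\<close>
  to the same line, so the union below is the image of \<open>x\<close> under any one of them; see
  \<open>pgl_act_coset\<close>.\<close>

definition pgl_act :: "('a::field ^ 2 ^ 2) set \<Rightarrow> 'a proj_point \<Rightarrow> 'a proj_point" where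
  "pgl_act M x = (\<Union>A\<in>M. (\<lambda>v. A *v v) ` x)"

definition coord_act :: "('a::field \<Rightarrow> 'a) \<Rightarrow> 'a proj_point \<Rightarrow> 'a proj_point" where
  "coord_act \<phi> x = (\<lambda>v. \<chi> i. \<phi> (v $ i)) ` x"

definition CM_map :: "('a::field \<Rightarrow> 'a) \<Rightarrow> ('a ^ 2 ^ 2) set \<Rightarrow> 'a proj_point \<Rightarrow> 'a proj_point" where
  "CM_map \<phi> M x = (if M \<in> PSL2 then pgl_act M x else pgl_act M (coord_act \<phi> x))"

definition CM_points :: "('a::field proj_point \<times> 'a proj_point) set" where
  "CM_points = PG1 \<times> PG1"

definition CM_circles :: "('a::field \<Rightarrow> 'a) \<Rightarrow> ('a proj_point \<times> 'a proj_point) set set" where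
  "CM_circles \<phi> = {{(x, CM_map \<phi> M x) |x. x \<in> PG1} |M. M \<in> carrier PGL2}"

definition intersecting_family ::
    "('a::field \<Rightarrow> 'a) \<Rightarrow> ('a proj_point \<times> 'a proj_point) set set \<Rightarrow> bool" where
  "intersecting_family \<phi> F \<longleftrightarrow> F \<subseteq> CM_circles \<phi> \<and> (\<forall>C\<in>F. \<forall>D\<in>F. C \<inter> D \<noteq> {})"

lemma mat_mult_vec: "(mat c ** A) *v v = c *s (A *v v)"
  for A :: "'a::field ^ 2 ^ 2"
  by (simp add: vec_eq_iff matrix_vector_mult_def matrix_matrix_mult_def mat_def
      sum_2 forall_2 algebra_simps)

lemma pgl_act_coset:
  fixes A :: "'a::field ^ 2 ^ 2"
  assumes x: "x \<in> PG1"
  shows "pgl_act (scalars2 #>\<^bsub>GL2\<^esub> A) x = (\<lambda>v. A *v v) ` x"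
proof -
  have scale: "c *s v \<in> x" if "v \<in> x" for c v
    using x that by (simp add: PG1_def vec.subspace_scale)
  have coset: "scalars2 #>\<^bsub>GL2\<^esub> A = {mat c ** A |c. c \<noteq> 0}"
    by (auto simp: r_coset_def scalars2_def GL2_def)
  have "(mat c ** A) *v v \<in> (\<lambda>v. A *v v) ` x" if "v \<in> x" for c v
    using scale[OF that, of c] by (auto simp: mat_mult_vec vec.scale intro!: image_eqI[of _ _ "c *s v"])
  moreover have "A *v v \<in> pgl_act (scalars2 #>\<^bsub>GL2\<^esub> A) x" if "v \<in> x" for v
    unfolding pgl_act_def coset
    using that by (auto intro!: exI[of _ "mat 1 ** A"] exI[of _ "1::'a"] simp: mat_mult_vec)
  ultimately show ?thesis
    by (auto simp: pgl_act_def coset)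
qed

end

theory Submission
  imports Defs
begin

text \<open>
  Three points of pairwise distinct coordinates lie on exactly one circle, so everything happens in
  a finite Minkowski plane. For a set \<open>F\<close> of circles let \<open>N p\<close> and \<open>N p p'\<close> count the members of
  \<open>F\<close> through one and two points. For fixed \<open>a \<noteq> c\<close> the numbers \<open>N (a, b) (c, d)\<close> form a matrix
  with empty diagonal and row and column sums \<open>N (a, b)\<close>, \<open>N (c, d)\<close>, so their sum of squares is
  at least that of the matrix of the form \<open>u b + v d\<close> with the same margins. Summed over \<open>a\<close> and \<open>c\<close>
  this is an inequality between pairs of circles that depends only on \<open>card (C \<inter> D)\<close>, and for
  intersecting \<open>F\<close> it reads \<open>card F \<le> q (q - 1)\<close>.

  In case of equality \<open>N (a, b) (c, d)\<close> is an explicit linear combination of \<open>N (a, b)\<close>,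
  \<open>N (c, d)\<close>, \<open>N (a, d)\<close>, \<open>N (c, b)\<close>. Counting the members of \<open>F\<close> touching a circle at \<open>p\<close>
  then shows that every class of circles touching each other at \<open>p\<close> contains equally many
  members \<open>k p\<close> of \<open>F\<close>, whence \<open>N p = (q - 1) k p\<close>. The matrix \<open>k\<close> is integral and nonnegative with
  all row and column sums \<open>q\<close>, and the linear relation forces an entry \<open>q\<close>.
\<close>

section \<open>Integer matrices with constant row and column sums\<close>

text \<open>In a 2 x 2 minor with diagonal sum \<open>X\<close> and antidiagonal sum
  \<open>Y\<close>, \<open>q + 1\<close> divides \<open>X - Y\<close>, while the row sums give
  \<open>X + Y \<le> 2 * q\<close>; with \<open>m \<le> q\<close> this leaves \<open>X = Y\<close>,
  or one of them \<open>0\<close> and the other \<open>q + 1\<close>. Not all minors have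
  \<open>X = Y\<close>, since \<open>k\<close> would then be constant and \<open>q + 1\<close> would
  divide \<open>q\<close>. A minor with \<open>X \<noteq> Y\<close> forces every column of its two
  rows into one of two shapes, and the row sums do the rest.\<close>

lemma matrix_extremal_entry:
  fixes k :: "'p \<Rightarrow> 'p \<Rightarrow> int" and q :: int
  assumes fin: "finite \<Omega>" and card: "int (card \<Omega>) = q + 1" and q: "q \<ge> 2"
    and nonneg: "\<And>a b. a \<in> \<Omega> \<Longrightarrow> b \<in> \<Omega> \<Longrightarrow> 0 \<le> k a b"
    and row: "\<And>a. a \<in> \<Omega> \<Longrightarrow> (\<Sum>b\<in>\<Omega>. k a b) = q"
    and col: "\<And>b. b \<in> \<Omega> \<Longrightarrow> (\<Sum>a\<in>\<Omega>. k a b) = q"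
    and minor: "\<And>a b c d. \<lbrakk>a \<in> \<Omega>; b \<in> \<Omega>; c \<in> \<Omega>; d \<in> \<Omega>; a \<noteq> c; b \<noteq> d\<rbrakk> \<Longrightarrow>
      \<exists>m. m \<le> q \<and> (q + 1) * m = q * (k a b + k c d) + k a d + k c b"
  shows "\<exists>a\<in>\<Omega>. \<exists>b\<in>\<Omega>. k a b = q"
proof -
  have two: "k a b + k a d \<le> q" if "a \<in> \<Omega>" "b \<in> \<Omega>" "d \<in> \<Omega>" "b \<noteq> d" for a b d
  proof -
    have "(\<Sum>e\<in>{b, d}. k a e) \<le> (\<Sum>e\<in>\<Omega>. k a e)"
      using that by (intro sum_mono2 fin) (auto intro: nonneg)
    then show ?thesis using that row by simp
  qed
  have dich: "k a b + k c d = k a d + k c b \<or> (k a b + k c d = q + 1 \<and> k a d = 0 \<and> k c b = 0)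
      \<or> (k a b = 0 \<and> k c d = 0 \<and> k a d + k c b = q + 1)"
    if in\<Omega>: "a \<in> \<Omega>" "b \<in> \<Omega>" "c \<in> \<Omega>" "d \<in> \<Omega>" "a \<noteq> c" "b \<noteq> d" for a b c d
  proof -
    define X Y where "X = k a b + k c d" and "Y = k a d + k c b"
    obtain m where m: "m \<le> q" "(q + 1) * m = q * X + Y"
      using minor[OF in\<Omega>] unfolding X_def Y_def by (auto simp: algebra_simps)
    obtain m' where m': "m' \<le> q" "(q + 1) * m' = q * Y + X"
      using minor[of a d c b] in\<Omega> unfolding X_def Y_def by (auto simp: algebra_simps)
    have XY: "X + Y \<le> 2 * q" "0 \<le> X" "0 \<le> Y"
      using two[of a b d] two[of c b d] in\<Omega> nonneg unfolding X_def Y_def by (auto simp: add_nonneg_nonneg)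
    have e1: "X - Y = (q + 1) * (X - m)" using m by (simp add: algebra_simps)
    have e2: "Y - X = (q + 1) * (Y - m')" using m' by (simp add: algebra_simps)
    have "\<bar>(q + 1) * (X - m)\<bar> < (q + 1) * 2" unfolding e1[symmetric] abs_less_iff using XY by simp
    then have "(q + 1) * \<bar>X - m\<bar> < (q + 1) * 2" using q by (simp add: abs_mult)
    then have "\<bar>X - m\<bar> < 2" using q by (subst (asm) mult_less_cancel_left_pos) auto
    then consider "X - m = 0" | "X - m = 1" | "X - m = -1" by linarith
    then show ?thesis
    proof cases
      case 1 then show ?thesis using e1 X_def Y_def by simp
    next
      case 2
      then have "X = Y + q + 1" using e1 by simp
      \<comment> \<open>Here \<open>m \<le> q\<close> is decisive: the row sums alone would allow
        \<open>X = Y + q + 1\<close> with positive \<open>Y\<close>.\<close>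
      moreover have "X \<le> q + 1" using 2 m by simp
      ultimately have "X = q + 1" "Y = 0" using XY by auto
      then show ?thesis
        using nonneg[of a b] nonneg[of c d] nonneg[of a d] nonneg[of c b] in\<Omega>
        unfolding X_def Y_def by simp
    next
      case 3
      then have Y: "Y = X + q + 1" using e1 by simp
      then have "(q + 1) * (Y - m') = (q + 1) * 1" using e2 by simp
      then have "Y - m' = 1" using q by (subst (asm) mult_left_cancel) auto
      then have "Y \<le> q + 1" using m' by simp
      then have "Y = q + 1" "X = 0" using Y XY by auto
      then show ?thesis
        using nonneg[of a b] nonneg[of c d] nonneg[of a d] nonneg[of c b] in\<Omega>
        unfolding X_def Y_def by simp
    qed
  qed
  have nonadd: "\<exists>a\<in>\<Omega>. \<exists>c\<in>\<Omega>. \<exists>b\<in>\<Omega>. \<exists>d\<in>\<Omega>. a \<noteq> c \<and> b \<noteq> d \<and> k a b + k c d \<noteq> k a d + k c b"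
    (is "\<exists>a\<in>\<Omega>. \<exists>c\<in>\<Omega>. \<exists>b\<in>\<Omega>. \<exists>d\<in>\<Omega>. ?P a c b d")
  proof (rule ccontr)
    assume "\<not> ?thesis"
    then have *: "\<not> ?P a c b d" if "a \<in> \<Omega>" "c \<in> \<Omega>" "b \<in> \<Omega>" "d \<in> \<Omega>" for a c b d
      using that by (meson bexI)
    have add: "k a b - k c b = k a d - k c d"
      if "a \<in> \<Omega>" "b \<in> \<Omega>" "c \<in> \<Omega>" "d \<in> \<Omega>" for a b c d
    proof (cases "a = c \<or> b = d")
      case False
      then have "k a b + k c d = k a d + k c b"
        using *[OF that(1,3,2,4)] by simp
      then show ?thesis by linarith
    qed auto
    \<comment> \<open>The difference of two rows does not depend on the column, and both rows sum to
      \<open>q\<close>, so it vanishes.\<close>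
    have eq: "k a b = k c b" if "a \<in> \<Omega>" "b \<in> \<Omega>" "c \<in> \<Omega>" for a b c
    proof -
      have "(\<Sum>d\<in>\<Omega>. k a d - k c d) = (\<Sum>d\<in>\<Omega>. k a b - k c b)"
        by (intro sum.cong refl add) (use that in auto)
      then have "0 = (q + 1) * (k a b - k c b)" using row that card by (simp add: sum_subtractf)
      then show ?thesis using q by auto
    qed
    have "\<Omega> \<noteq> {}" using card q by auto
    then obtain b where b: "b \<in> \<Omega>" by blast
    have "(\<Sum>a\<in>\<Omega>. k a b) = (\<Sum>a\<in>\<Omega>. k b b)" by (intro sum.cong refl eq b)
    then have e: "q = (q + 1) * k b b" using col b card by simp
    have "k b b \<noteq> 0" using e q by auto
    then have "k b b \<ge> 1" using nonneg[OF b b] by linarith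
    then have "(q + 1) * 1 \<le> (q + 1) * k b b" using q by (intro mult_left_mono) auto
    then show False using e by simp
  qed
  have "\<exists>a\<in>\<Omega>. \<exists>c\<in>\<Omega>. \<exists>b\<in>\<Omega>. \<exists>d\<in>\<Omega>. a \<noteq> c \<and> b \<noteq> d \<and> k a b + k c d = q + 1 \<and> k a d = 0 \<and> k c b = 0"
  proof -
    obtain a b c d where *: "a \<in> \<Omega>" "b \<in> \<Omega>" "c \<in> \<Omega>" "d \<in> \<Omega>" "a \<noteq> c" "b \<noteq> d"
      "k a b + k c d \<noteq> k a d + k c b" using nonadd by blast
    then consider "k a b + k c d = q + 1" "k a d = 0" "k c b = 0"
      | "k a d + k c b = q + 1" "k a b = 0" "k c d = 0"
      using dich[OF *(1-6)] by blast
    then show ?thesis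
    proof cases
      case 1 then show ?thesis using *(1-6) by blast
    next
      case 2 then show ?thesis using *(1-5) *(6)[symmetric] by blast
    qed
  qed
  then obtain a b c d where abcd: "a \<in> \<Omega>" "b \<in> \<Omega>" "c \<in> \<Omega>" "d \<in> \<Omega>" "a \<noteq> c" "b \<noteq> d"
      "k a b + k c d = q + 1" "k a d = 0" "k c b = 0" by blast
  define x where "x = k a b"
  have kcd: "k c d = q + 1 - x" using abcd x_def by simp
  have x1: "x \<ge> 1" using two[of c d b] abcd nonneg[of c b] kcd by simp
  \<comment> \<open>Column \<open>e\<close> of the two rows is \<open>(x, 0)\<close> or
    \<open>(0, q + 1 - x)\<close>. The equation is that of the line through these two pairs; being
    linear, it can be summed over \<open>e\<close>.\<close>
  have vals: "(q + 1 - x) * k a e + x * k c e = x * (q + 1 - x)" if e: "e \<in> \<Omega>" for e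
  proof (cases "e = b \<or> e = d")
    case True then show ?thesis using abcd kcd x_def by auto
  next
    case False
    have *: "k c e \<ge> 0" "k a e \<ge> 0" using nonneg abcd e by auto
    have d1: "x + k c e = k a e \<or> (x + k c e = q + 1 \<and> k a e = 0)"
      using dich[of a b c e] abcd False e x1 * unfolding x_def by auto
    have d2: "x + k c e = k a e \<Longrightarrow> k c e = 0"
      using dich[of a e c d] abcd False e x1 kcd q * by auto
    from d1 show ?thesis
    proof
      assume "x + k c e = k a e"
      with d2 have "k c e = 0" "k a e = x" by auto
      then show ?thesis by simp
    next
      assume "x + k c e = q + 1 \<and> k a e = 0"
      then have "k c e = q + 1 - x" "k a e = 0" by auto
      then show ?thesis by simp
    qed
  qed
  have "(\<Sum>e\<in>\<Omega>. (q + 1 - x) * k a e + x * k c e) = (\<Sum>e\<in>\<Omega>. x * (q + 1 - x))"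
    using vals by (intro sum.cong) auto
  then have "(q + 1 - x) * q + x * q = (q + 1) * (x * (q + 1 - x))"
    using row abcd card by (simp add: sum.distrib flip: sum_distrib_left)
  \<comment> \<open>Up to the factor \<open>q + 1\<close> the sum says
    \<open>q = x * (q + 1 - x)\<close>, a quadratic equation with roots \<open>1\<close> and
    \<open>q\<close>.\<close>
  then have "(q + 1) * ((x - 1) * (x - q)) = 0" by (simp add: algebra_simps)
  then have "x = 1 \<or> x = q" using q by auto
  then have "k a b = q \<or> k c d = q" using kcd x_def by auto
  then show ?thesis using abcd by blast
qed

section \<open>Finite Minkowski planes\<close>

text \<open>The circles are the graphs of a sharply 3-transitive set of permutations of
  \<open>\<Omega>\<close>, not necessarily a group. The order \<open>q\<close> is an integer so that
  the counting identities can use subtraction freely.\<close>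

locale minkowski_plane =
  fixes \<Omega> :: "'p set" and \<C> :: "('p \<times> 'p) set set" and q :: int
  assumes finite_\<Omega>: "finite \<Omega>"
    and card_\<Omega>: "int (card \<Omega>) = q + 1"
    and q_ge_2: "q \<ge> 2"
    and circle_subset: "C \<in> \<C> \<Longrightarrow> C \<subseteq> \<Omega> \<times> \<Omega>"
    and circle_row: "C \<in> \<C> \<Longrightarrow> a \<in> \<Omega> \<Longrightarrow> \<exists>!b. (a, b) \<in> C"
    and circle_col: "C \<in> \<C> \<Longrightarrow> b \<in> \<Omega> \<Longrightarrow> \<exists>!a. (a, b) \<in> C"
    and circle_three_points:
      "\<lbrakk>{a, c, e} \<subseteq> \<Omega>; distinct [a, c, e]; {b, d, f} \<subseteq> \<Omega>; distinct [b, d, f]\<rbrakk> \<Longrightarrow>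
        \<exists>!C. C \<in> \<C> \<and> (a, b) \<in> C \<and> (c, d) \<in> C \<and> (e, f) \<in> C"
begin

section \<open>Elementary incidence properties of circles\<close>

lemma finite_circles: "finite \<C>"
proof (rule finite_subset)
  show "\<C> \<subseteq> Pow (\<Omega> \<times> \<Omega>)" using circle_subset by auto
qed (simp add: finite_\<Omega>)

lemma finite_circle: "C \<in> \<C> \<Longrightarrow> finite C"
  using circle_subset finite_\<Omega> by (meson finite_SigmaI finite_subset)

lemma circle_fst_eq: "C \<in> \<C> \<Longrightarrow> (a, b) \<in> C \<Longrightarrow> (a, d) \<in> C \<Longrightarrow> b = d"
  using circle_row circle_subset by blast

lemma circle_snd_eq: "C \<in> \<C> \<Longrightarrow> (a, b) \<in> C \<Longrightarrow> (c, b) \<in> C \<Longrightarrow> a = c"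
  using circle_col circle_subset by blast

lemma card_remove_\<Omega>: "a \<in> \<Omega> \<Longrightarrow> int (card (\<Omega> - {a})) = q"
proof -
  assume a: "a \<in> \<Omega>"
  then have "card \<Omega> > 0" using finite_\<Omega> by (auto simp: card_gt_0_iff)
  then show ?thesis using a card_\<Omega> by (simp add: card_Diff_singleton of_nat_diff)
qed

lemma sum_row: "C \<in> \<C> \<Longrightarrow> a \<in> \<Omega> \<Longrightarrow> (\<Sum>b\<in>\<Omega>. of_bool ((a, b) \<in> C) :: int) = 1"
proof -
  assume C: "C \<in> \<C>" and a: "a \<in> \<Omega>"
  obtain b where b: "(a, b) \<in> C" using circle_row[OF C a] by blast
  then have "\<Omega> \<inter> {b. (a, b) \<in> C} = {b}"
    using circle_fst_eq[OF C] circle_subset[OF C] by blast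
  then show ?thesis using finite_\<Omega> by simp
qed

lemma sum_col: "C \<in> \<C> \<Longrightarrow> b \<in> \<Omega> \<Longrightarrow> (\<Sum>a\<in>\<Omega>. of_bool ((a, b) \<in> C) :: int) = 1"
proof -
  assume C: "C \<in> \<C>" and b: "b \<in> \<Omega>"
  obtain a where a: "(a, b) \<in> C" using circle_col[OF C b] by blast
  then have "\<Omega> \<inter> {a. (a, b) \<in> C} = {a}"
    using circle_snd_eq[OF C] circle_subset[OF C] by blast
  then show ?thesis using finite_\<Omega> by simp
qed

lemma bij_betw_snd_circle: "C \<in> \<C> \<Longrightarrow> bij_betw snd C \<Omega>"
  unfolding bij_betw_def
proof
  assume C: "C \<in> \<C>"
  show "inj_on snd C" using circle_snd_eq[OF C] by (auto simp: inj_on_def)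
  show "snd ` C = \<Omega>"
    using circle_col[OF C] circle_subset[OF C] by force
qed

lemma bij_betw_fst_circle: "C \<in> \<C> \<Longrightarrow> bij_betw fst C \<Omega>"
  unfolding bij_betw_def
proof
  assume C: "C \<in> \<C>"
  show "inj_on fst C" using circle_fst_eq[OF C] by (auto simp: inj_on_def)
  show "fst ` C = \<Omega>"
    using circle_row[OF C] circle_subset[OF C] by force
qed

lemma card_circle: "C \<in> \<C> \<Longrightarrow> int (card C) = q + 1"
  using bij_betw_fst_circle bij_betw_same_card card_\<Omega> by metis

lemma card_inter_circles:
  assumes C: "C \<in> \<C>" and D: "D \<in> \<C>" and "C \<noteq> D"
  shows "card (C \<inter> D) \<le> 2"
proof (rule ccontr)
  assume "\<not> ?thesis"
  then have "3 \<le> card (C \<inter> D)" by simp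
  then obtain T where T: "T \<subseteq> C \<inter> D" "card T = 3"
    by (meson obtain_subset_with_card_n)
  then obtain x y z where xyz: "T = {x, y, z}" "x \<noteq> y" "y \<noteq> z" "x \<noteq> z"
    by (auto simp: card_3_iff)
  obtain a b c d e f where [simp]: "x = (a, b)" "y = (c, d)" "z = (e, f)"
    by (metis surj_pair)
  have mem: "(a, b) \<in> C" "(c, d) \<in> C" "(e, f) \<in> C" "(a, b) \<in> D" "(c, d) \<in> D" "(e, f) \<in> D"
    using T xyz by auto
  have "distinct [a, c, e]" "distinct [b, d, f]"
    using xyz circle_fst_eq[OF C] circle_snd_eq[OF C] mem by auto
  moreover have "{a, c, e} \<subseteq> \<Omega>" "{b, d, f} \<subseteq> \<Omega>" using mem circle_subset[OF C] by auto
  ultimately have "C = D" using circle_three_points[of a c e b d f] C D mem by blast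
  then show False using \<open>C \<noteq> D\<close> by simp
qed

lemma offdiag_swap:
  "(\<Sum>b\<in>\<Omega>. \<Sum>d\<in>\<Omega> - {b}. g b d) = (\<Sum>d\<in>\<Omega>. \<Sum>b\<in>\<Omega> - {d}. g b d)"
    for g :: "'p \<Rightarrow> 'p \<Rightarrow> int"
proof -
  have "\<Omega> - {b} = {d \<in> \<Omega>. b \<noteq> d}" "\<Omega> - {b} = {d \<in> \<Omega>. d \<noteq> b}" for b by auto
  then show ?thesis
    using sum.swap_restrict[OF finite_\<Omega> finite_\<Omega>, of g "\<lambda>b d. b \<noteq> d"] by simp
qed

lemma sum_rect:
  assumes "finite A" "finite B"
  shows "(\<Sum>a\<in>A. \<Sum>b\<in>B. of_bool ((a, b) \<in> X) * g (a, b)) = (\<Sum>p\<in>X \<inter> A \<times> B. g p :: int)"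
proof -
  have "(\<Sum>a\<in>A. \<Sum>b\<in>B. of_bool ((a, b) \<in> X) * g (a, b))
      = (\<Sum>p\<in>A \<times> B. if p \<in> X then g p else 0)"
    unfolding sum.cartesian_product case_prod_unfold prod.collapse by (intro sum.cong) auto
  also have "\<dots> = (\<Sum>p\<in>X \<inter> A \<times> B. g p)"
    using assms by (subst Int_commute) (simp add: sum.inter_restrict)
  finally show ?thesis .
qed

lemma sum_circle:
  assumes "X \<subseteq> \<Omega> \<times> \<Omega>"
  shows "(\<Sum>a\<in>\<Omega>. \<Sum>b\<in>\<Omega>. of_bool ((a, b) \<in> X) * g (a, b)) = (\<Sum>p\<in>X. g p :: int)"
  using sum_rect[OF finite_\<Omega> finite_\<Omega>, of X g] assms by (simp add: inf_absorb1)

section \<open>Members of a family through one point, through two points, and touching a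
  circle\<close>

definition deg :: "('p \<times> 'p) set set \<Rightarrow> 'p \<times> 'p \<Rightarrow> int" where
  "deg F p = (\<Sum>C\<in>F. of_bool (p \<in> C))"

definition codeg :: "('p \<times> 'p) set set \<Rightarrow> 'p \<times> 'p \<Rightarrow> 'p \<times> 'p \<Rightarrow> int" where
  "codeg F p p' = (\<Sum>C\<in>F. of_bool (p \<in> C) * of_bool (p' \<in> C))"

text \<open>The circle \<open>C\<close> itself is counted when it belongs to \<open>F\<close>. With
  this convention the number for the whole plane is \<open>q\<close>, the size of a parallel class
  in the affine plane derived at \<open>p\<close>.\<close>

definition touch :: "('p \<times> 'p) set set \<Rightarrow> 'p \<times> 'p \<Rightarrow> ('p \<times> 'p) set \<Rightarrow> int" where
  "touch F p C = (\<Sum>D\<in>F. of_bool (p \<in> D) * of_bool (D = C \<or> D \<inter> C = {p}))"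

lemma codeg_commute: "codeg F p p' = codeg F p' p"
  by (simp add: codeg_def mult.commute)

lemma deg_eq_card: "finite F \<Longrightarrow> deg F p = int (card {C \<in> F. p \<in> C})"
  by (simp add: deg_def Int_def)

lemma codeg_eq_card: "finite F \<Longrightarrow> codeg F p p' = int (card {C \<in> F. p \<in> C \<and> p' \<in> C})"
  by (simp add: codeg_def Int_def flip: of_bool_conj)

context
  fixes F :: "('p \<times> 'p) set set"
  assumes F: "F \<subseteq> \<C>"
begin

lemma sum_deg_row: "a \<in> \<Omega> \<Longrightarrow> (\<Sum>b\<in>\<Omega>. deg F (a, b)) = int (card F)"
  unfolding deg_def using F sum_row by (subst sum.swap) (simp add: subset_iff)

lemma sum_deg_col: "b \<in> \<Omega> \<Longrightarrow> (\<Sum>a\<in>\<Omega>. deg F (a, b)) = int (card F)"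
  unfolding deg_def using F sum_col by (subst sum.swap) (simp add: subset_iff)

text \<open>A circle through \<open>(a, b)\<close> has exactly one point with first coordinate
  \<open>c\<close>, and that point is not \<open>(c, b)\<close>; leaving out \<open>d = b\<close>
  therefore loses nothing.\<close>

lemma sum_codeg_row:
  assumes "c \<in> \<Omega>" "a \<noteq> c"
  shows "(\<Sum>d\<in>\<Omega> - {b}. codeg F (a, b) (c, d)) = deg F (a, b)"
proof -
  have "(\<Sum>d\<in>\<Omega> - {b}. of_bool ((a, b) \<in> C) * of_bool ((c, d) \<in> C)) = (of_bool ((a, b) \<in> C) :: int)"
    if C: "C \<in> F" for C
  proof (cases "(a, b) \<in> C")
    case True
    then have "(c, b) \<notin> C" using circle_snd_eq assms C F by blast
    then have "(\<Sum>d\<in>\<Omega> - {b}. of_bool ((c, d) \<in> C)) = (\<Sum>d\<in>\<Omega>. of_bool ((c, d) \<in> C) :: int)"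
      using finite_\<Omega> by (intro sum.mono_neutral_left) auto
    then show ?thesis using sum_row[of C c] C F assms True by auto
  qed simp
  then show ?thesis unfolding codeg_def deg_def by (subst sum.swap) simp
qed

lemma sum_codeg_col:
  assumes "d \<in> \<Omega>" "b \<noteq> d"
  shows "(\<Sum>c\<in>\<Omega> - {a}. codeg F (a, b) (c, d)) = deg F (a, b)"
proof -
  have "(\<Sum>c\<in>\<Omega> - {a}. of_bool ((a, b) \<in> C) * of_bool ((c, d) \<in> C)) = (of_bool ((a, b) \<in> C) :: int)"
    if C: "C \<in> F" for C
  proof (cases "(a, b) \<in> C")
    case True
    then have "(a, d) \<notin> C" using circle_fst_eq assms C F by blast
    then have "(\<Sum>c\<in>\<Omega> - {a}. of_bool ((c, d) \<in> C)) = (\<Sum>c\<in>\<Omega>. of_bool ((c, d) \<in> C) :: int)"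
      using finite_\<Omega> by (intro sum.mono_neutral_left) auto
    then show ?thesis using sum_col[of C d] C F assms True by auto
  qed simp
  then show ?thesis unfolding codeg_def deg_def by (subst sum.swap) simp
qed

lemma sum_codeg_row': 
  assumes "a \<in> \<Omega>" "a \<noteq> c"
  shows "(\<Sum>b\<in>\<Omega> - {d}. codeg F (a, b) (c, d)) = deg F (c, d)"
  using sum_codeg_row[of a c d] assms by (simp add: codeg_commute)

end

text \<open>Distinct points of a circle differ in both coordinates, so the off-diagonal ranges
  capture every ordered pair of distinct points of \<open>X\<close>. The order of summation keeps
  \<open>a\<close> and \<open>c\<close> outermost, since the least-squares argument works with
  \<open>a\<close> and \<open>c\<close> fixed.\<close>

lemma sum_pairs_mem:
  assumes X: "X \<subseteq> C" and C: "C \<in> \<C>"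
  shows "(\<Sum>a\<in>\<Omega>. \<Sum>c\<in>\<Omega> - {a}. \<Sum>b\<in>\<Omega>. \<Sum>d\<in>\<Omega> - {b}. of_bool ((a, b) \<in> X) * of_bool ((c, d) \<in> X))
    = int (card X) * (int (card X) - 1)"
proof -
  have fX: "finite X" using X C finite_circle finite_subset by blast
  have X\<Omega>: "X \<subseteq> \<Omega> \<times> \<Omega>" using X C circle_subset by blast
  have inner: "(\<Sum>c\<in>\<Omega> - {a}. \<Sum>d\<in>\<Omega> - {b}. of_bool ((c, d) \<in> X)) = int (card X) - 1"
    if ab: "(a, b) \<in> X" for a b
  proof -
    have "(\<Sum>c\<in>\<Omega> - {a}. \<Sum>d\<in>\<Omega> - {b}. of_bool ((c, d) \<in> X))
        = int (card (((\<Omega> - {a}) \<times> (\<Omega> - {b})) \<inter> X))"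
      unfolding sum.cartesian_product case_prod_unfold prod.collapse
      using finite_\<Omega> by simp
    also have "((\<Omega> - {a}) \<times> (\<Omega> - {b})) \<inter> X = X - {(a, b)}"
    proof -
      have "c \<in> \<Omega> \<and> d \<in> \<Omega> \<and> c \<noteq> a \<and> d \<noteq> b" if "(c, d) \<in> X" "(c, d) \<noteq> (a, b)" for c d
        using that ab X X\<Omega> circle_fst_eq[OF C, of a b d] circle_snd_eq[OF C, of a b c] by auto
      then show ?thesis by auto
    qed
    also have "int (card \<dots>) = int (card X) - 1"
      using card_Suc_Diff1[OF fX ab] by linarith
    finally show ?thesis .
  qed
  have "(\<Sum>a\<in>\<Omega>. \<Sum>c\<in>\<Omega> - {a}. \<Sum>b\<in>\<Omega>. \<Sum>d\<in>\<Omega> - {b}. of_bool ((a, b) \<in> X) * of_bool ((c, d) \<in> X))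
    = (\<Sum>a\<in>\<Omega>. \<Sum>b\<in>\<Omega>. of_bool ((a, b) \<in> X) * (\<Sum>c\<in>\<Omega> - {a}. \<Sum>d\<in>\<Omega> - {b}. of_bool ((c, d) \<in> X)) :: int)"
    by (rule sum.cong[OF refl], subst sum.swap) (simp add: sum_distrib_left)
  also have "\<dots> = (\<Sum>a\<in>\<Omega>. \<Sum>b\<in>\<Omega>. of_bool ((a, b) \<in> X) * (int (card X) - 1))"
    by (intro sum.cong refl) (simp add: inner)
  also have "\<dots> = (\<Sum>p\<in>X. int (card X) - 1)"
    by (rule sum_circle[OF X\<Omega>])
  finally show ?thesis by simp
qed

lemma sum4_swap:
  "(\<Sum>a\<in>\<Omega>. \<Sum>c\<in>\<Omega> - {a}. \<Sum>b\<in>\<Omega>. \<Sum>d\<in>\<Omega> - {b}. \<Sum>C\<in>F. g C a b c d)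
    = (\<Sum>C\<in>F. \<Sum>a\<in>\<Omega>. \<Sum>c\<in>\<Omega> - {a}. \<Sum>b\<in>\<Omega>. \<Sum>d\<in>\<Omega> - {b}. g C a b c d)"
  for g :: "_ \<Rightarrow> 'p \<Rightarrow> 'p \<Rightarrow> 'p \<Rightarrow> 'p \<Rightarrow> int"
proof -
  have s: "(\<Sum>x\<in>A. \<Sum>C\<in>F. h x C) = (\<Sum>C\<in>F. \<Sum>x\<in>A. h x C)"
    for h :: "'p \<Rightarrow> _ \<Rightarrow> int" and A by (rule sum.swap)
  show ?thesis by (simp only: s)
qed

section \<open>Second moments of the degrees and the sum of squared defects\<close>

context
  fixes F :: "('p \<times> 'p) set set"
  assumes F: "F \<subseteq> \<C>"
begin

lemma sum_deg_sq:
  "(\<Sum>a\<in>\<Omega>. \<Sum>b\<in>\<Omega>. (deg F (a, b))\<^sup>2) = (\<Sum>C\<in>F. \<Sum>D\<in>F. int (card (C \<inter> D)))"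
proof -
  have s: "(\<Sum>x\<in>\<Omega>. \<Sum>C\<in>F. h x C) = (\<Sum>C\<in>F. \<Sum>x\<in>\<Omega>. h x C)"
    for h :: "'p \<Rightarrow> _ \<Rightarrow> int" by (rule sum.swap)
  have "(\<Sum>a\<in>\<Omega>. \<Sum>b\<in>\<Omega>. (deg F (a, b))\<^sup>2)
      = (\<Sum>a\<in>\<Omega>. \<Sum>b\<in>\<Omega>. \<Sum>C\<in>F. \<Sum>D\<in>F. of_bool ((a, b) \<in> C \<inter> D))"
    by (simp add: deg_def power2_eq_square sum_product flip: of_bool_conj)
  also have "\<dots> = (\<Sum>C\<in>F. \<Sum>D\<in>F. \<Sum>a\<in>\<Omega>. \<Sum>b\<in>\<Omega>. of_bool ((a, b) \<in> C \<inter> D))"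
    by (simp only: s)
  also have "\<dots> = (\<Sum>C\<in>F. \<Sum>D\<in>F. int (card (C \<inter> D)))"
  proof (intro sum.cong refl)
    fix C D assume "C \<in> F" "D \<in> F"
    then have "C \<inter> D \<subseteq> \<Omega> \<times> \<Omega>" using circle_subset F by blast
    from sum_circle[OF this, of "\<lambda>_. 1"]
    show "(\<Sum>a\<in>\<Omega>. \<Sum>b\<in>\<Omega>. of_bool ((a, b) \<in> C \<inter> D)) = int (card (C \<inter> D))" by simp
  qed
  finally show ?thesis .
qed

text \<open>Expanding the square counts ordered pairs of members, equal ones included, together with
  ordered pairs of distinct common points; \<open>sum_pairs_mem\<close> is applied to
  \<open>C \<inter> D\<close>.\<close>

lemma sum_codeg_sq:
  "(\<Sum>a\<in>\<Omega>. \<Sum>c\<in>\<Omega> - {a}. \<Sum>b\<in>\<Omega>. \<Sum>d\<in>\<Omega> - {b}. (codeg F (a, b) (c, d))\<^sup>2)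
    = (\<Sum>C\<in>F. \<Sum>D\<in>F. int (card (C \<inter> D)) * (int (card (C \<inter> D)) - 1))"
proof -
  have "(\<Sum>a\<in>\<Omega>. \<Sum>c\<in>\<Omega> - {a}. \<Sum>b\<in>\<Omega>. \<Sum>d\<in>\<Omega> - {b}. (codeg F (a, b) (c, d))\<^sup>2)
     = (\<Sum>a\<in>\<Omega>. \<Sum>c\<in>\<Omega> - {a}. \<Sum>b\<in>\<Omega>. \<Sum>d\<in>\<Omega> - {b}. \<Sum>C\<in>F. \<Sum>D\<in>F.
         of_bool ((a, b) \<in> C \<inter> D) * of_bool ((c, d) \<in> C \<inter> D))"
    by (simp add: codeg_def power2_eq_square sum_product conj_ac flip: of_bool_conj)
  also have "\<dots> = (\<Sum>C\<in>F. \<Sum>D\<in>F. \<Sum>a\<in>\<Omega>. \<Sum>c\<in>\<Omega> - {a}. \<Sum>b\<in>\<Omega>. \<Sum>d\<in>\<Omega> - {b}.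
         of_bool ((a, b) \<in> C \<inter> D) * of_bool ((c, d) \<in> C \<inter> D))"
    unfolding sum4_swap ..
  also have "\<dots> = (\<Sum>C\<in>F. \<Sum>D\<in>F. int (card (C \<inter> D)) * (int (card (C \<inter> D)) - 1))"
    using F by (intro sum.cong refl sum_pairs_mem[OF Int_lower1]) auto
  finally show ?thesis .
qed

text \<open>The deviation of \<open>deg F p\<close> from its mean \<open>card F / (q + 1)\<close> on
  a row or column, multiplied by \<open>q + 1\<close> to stay integral.\<close>

definition cdeg :: "'p \<times> 'p \<Rightarrow> int" where
  "cdeg p = (q + 1) * deg F p - int (card F)"

text \<open>Up to the factor \<open>q (q + 1) (q\<^sup>2 - 1)\<close>, which clears denominators, this is the difference between
  \<open>codeg F\<close> and its least-squares fit. It sums to zero over \<open>d\<close> and over \<open>b\<close>, hence is orthogonal to the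
  terms that do not involve \<open>d\<close> or do not involve \<open>b\<close>.\<close>

definition defect :: "'p \<Rightarrow> 'p \<Rightarrow> 'p \<Rightarrow> 'p \<Rightarrow> int" where
  "defect a b c d = q * (q + 1) * (q\<^sup>2 - 1) * codeg F (a, b) (c, d) - (q\<^sup>2 - 1) * int (card F)
     - q * (q * cdeg (a, b) + cdeg (c, b)) - q * (q * cdeg (c, d) + cdeg (a, d))"

lemma sum_cdeg_row: "a \<in> \<Omega> \<Longrightarrow> (\<Sum>b\<in>\<Omega>. cdeg (a, b)) = 0"
  using sum_deg_row[OF F] card_\<Omega>
  by (simp add: cdeg_def sum_subtractf flip: sum_distrib_left)

lemma sum_cdeg_col: "b \<in> \<Omega> \<Longrightarrow> (\<Sum>a\<in>\<Omega>. cdeg (a, b)) = 0"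
  using sum_deg_col[OF F] card_\<Omega>
  by (simp add: cdeg_def sum_subtractf flip: sum_distrib_left)

lemma sum_cdeg_row_remove: "a \<in> \<Omega> \<Longrightarrow> b \<in> \<Omega> \<Longrightarrow> (\<Sum>d\<in>\<Omega> - {b}. cdeg (a, d)) = - cdeg (a, b)"
  using sum_cdeg_row finite_\<Omega> by (simp add: sum_diff1)

lemma sum_cdeg_col_remove: "a \<in> \<Omega> \<Longrightarrow> b \<in> \<Omega> \<Longrightarrow> (\<Sum>c\<in>\<Omega> - {a}. cdeg (c, b)) = - cdeg (a, b)"
  using sum_cdeg_col finite_\<Omega> by (simp add: sum_diff1)

text \<open>The fit is the mean \<open>card F / (q * (q + 1))\<close> plus \<open>u b + v d\<close>,
  where \<open>u\<close> and \<open>v\<close> sum to zero. With the diagonal removed its centred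
  margins are \<open>q * u b - v b\<close> and \<open>q * v d - u d\<close>. Equating them with the
  deviations of \<open>deg F (a, b)\<close> and \<open>deg F (c, d)\<close> gives a 2 x 2 system of
  determinant \<open>q\<^sup>2 - 1\<close>, whose solution explains the coefficients
  \<open>q\<close> and \<open>1\<close> in \<open>defect\<close>.\<close>

lemma sum_defect_right:
  assumes "a \<in> \<Omega>" "c \<in> \<Omega>" "a \<noteq> c" "b \<in> \<Omega>"
  shows "(\<Sum>d\<in>\<Omega> - {b}. defect a b c d) = 0"
proof -
  have "(\<Sum>d\<in>\<Omega> - {b}. defect a b c d)
    = q * (q + 1) * (q\<^sup>2 - 1) * (\<Sum>d\<in>\<Omega> - {b}. codeg F (a, b) (c, d))
      - q * ((q\<^sup>2 - 1) * int (card F)) - q * (q * (q * cdeg (a, b) + cdeg (c, b)))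
      - q * (q * (\<Sum>d\<in>\<Omega> - {b}. cdeg (c, d)) + (\<Sum>d\<in>\<Omega> - {b}. cdeg (a, d)))"
    using assms card_remove_\<Omega>[of b]
    by (simp add: defect_def sum_subtractf sum.distrib flip: sum_distrib_left del: card_Diff_singleton card_Diff_insert)
  also have "\<dots> = q * (q + 1) * (q\<^sup>2 - 1) * deg F (a, b) - q * ((q\<^sup>2 - 1) * int (card F))
      - q * (q * (q * cdeg (a, b) + cdeg (c, b))) - q * (q * - cdeg (c, b) + - cdeg (a, b))"
    using assms sum_codeg_row[OF F, of c a b] sum_cdeg_row_remove[of c b] sum_cdeg_row_remove[of a b]
    by simp
  also have "\<dots> = 0"
    by (simp add: cdeg_def power2_eq_square algebra_simps)
  finally show ?thesis .
qed

lemma defect_commute: "defect a b c d = defect c d a b"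
  by (simp add: defect_def codeg_commute algebra_simps)

lemma sum_defect_left:
  assumes "a \<in> \<Omega>" "c \<in> \<Omega>" "a \<noteq> c" "d \<in> \<Omega>"
  shows "(\<Sum>b\<in>\<Omega> - {d}. defect a b c d) = 0"
  using sum_defect_right[of c a d] assms by (subst defect_commute) auto

text \<open>The Pythagorean identity: the defect is orthogonal to functions of \<open>b\<close>
  alone and of \<open>d\<close> alone, so its squared norm is \<open>\<kappa>\<close> times its
  inner product with \<open>codeg F\<close>. Expanding that product leaves only the margins of
  \<open>codeg F\<close>.\<close>

lemma sum_defect_sq_fixed:
  assumes ac: "a \<in> \<Omega>" "c \<in> \<Omega>" "a \<noteq> c"
  defines "\<kappa> \<equiv> q * (q + 1) * (q\<^sup>2 - 1)"
  shows "(\<Sum>b\<in>\<Omega>. \<Sum>d\<in>\<Omega> - {b}. (defect a b c d)\<^sup>2)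
    = \<kappa> * (\<kappa> * (\<Sum>b\<in>\<Omega>. \<Sum>d\<in>\<Omega> - {b}. (codeg F (a, b) (c, d))\<^sup>2)
        - (q\<^sup>2 - 1) * (int (card F))\<^sup>2
        - q * (\<Sum>b\<in>\<Omega>. deg F (a, b) * (q * cdeg (a, b) + cdeg (c, b)))
        - q * (\<Sum>d\<in>\<Omega>. deg F (c, d) * (q * cdeg (c, d) + cdeg (a, d))))"
proof -
  define l where "l = (q\<^sup>2 - 1) * int (card F)"
  define u where "u b = q * (q * cdeg (a, b) + cdeg (c, b))" for b
  define v where "v d = q * (q * cdeg (c, d) + cdeg (a, d))" for d
  let ?N = "\<lambda>b d. codeg F (a, b) (c, d)"
  have D: "defect a b c d = \<kappa> * ?N b d - l - u b - v d" for b d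
    by (simp add: defect_def \<kappa>_def l_def u_def v_def)
  have orth_u: "(\<Sum>b\<in>\<Omega>. \<Sum>d\<in>\<Omega> - {b}. w b * defect a b c d) = 0" for w
    using sum_defect_right[OF ac] by (simp flip: sum_distrib_left)
  have orth_v: "(\<Sum>b\<in>\<Omega>. \<Sum>d\<in>\<Omega> - {b}. w d * defect a b c d) = 0" for w
    using sum_defect_left[OF ac] by (subst offdiag_swap) (simp flip: sum_distrib_left)
  have "(\<Sum>b\<in>\<Omega>. \<Sum>d\<in>\<Omega> - {b}. (defect a b c d)\<^sup>2)
     = (\<Sum>b\<in>\<Omega>. \<Sum>d\<in>\<Omega> - {b}. \<kappa> * (?N b d * defect a b c d) - (l + u b) * defect a b c d
          - v d * defect a b c d)"
    by (intro sum.cong refl) (simp add: D power2_eq_square algebra_simps)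
  also have "\<dots> = \<kappa> * (\<Sum>b\<in>\<Omega>. \<Sum>d\<in>\<Omega> - {b}. ?N b d * defect a b c d)"
    using orth_u[of "\<lambda>b. l + u b"] orth_v[of v]
    by (simp only: sum_subtractf flip: sum_distrib_left)
  also have "(\<Sum>b\<in>\<Omega>. \<Sum>d\<in>\<Omega> - {b}. ?N b d * defect a b c d)
     = (\<Sum>b\<in>\<Omega>. \<Sum>d\<in>\<Omega> - {b}. \<kappa> * (?N b d)\<^sup>2 - (l + u b) * ?N b d - v d * ?N b d)"
    by (intro sum.cong refl) (simp add: D power2_eq_square algebra_simps)
  also have "\<dots> = \<kappa> * (\<Sum>b\<in>\<Omega>. \<Sum>d\<in>\<Omega> - {b}. (?N b d)\<^sup>2)
      - (\<Sum>b\<in>\<Omega>. (l + u b) * (\<Sum>d\<in>\<Omega> - {b}. ?N b d))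
      - (\<Sum>b\<in>\<Omega>. \<Sum>d\<in>\<Omega> - {b}. v d * ?N b d)"
    by (simp only: sum_subtractf flip: sum_distrib_left)
  also have "(\<Sum>b\<in>\<Omega>. \<Sum>d\<in>\<Omega> - {b}. v d * ?N b d) = (\<Sum>d\<in>\<Omega>. v d * (\<Sum>b\<in>\<Omega> - {d}. ?N b d))"
    by (subst offdiag_swap) (simp add: sum_distrib_left)
  also have "\<dots> = (\<Sum>d\<in>\<Omega>. v d * deg F (c, d))"
    using sum_codeg_row'[OF F ac(1,3)] by simp
  also have "(\<Sum>b\<in>\<Omega>. (l + u b) * (\<Sum>d\<in>\<Omega> - {b}. ?N b d)) = (\<Sum>b\<in>\<Omega>. (l + u b) * deg F (a, b))"
    using sum_codeg_row[OF F ac(2,3)] by simp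
  also have "\<dots> = l * int (card F) + (\<Sum>b\<in>\<Omega>. u b * deg F (a, b))"
    using sum_deg_row[OF F ac(1)] by (simp add: distrib_right sum.distrib flip: sum_distrib_left)
  finally show ?thesis
    by (simp add: l_def u_def v_def sum_distrib_left power2_eq_square algebra_simps)
qed

text \<open>After summation over \<open>a\<close> and \<open>c\<close>, the defect is controlled by
  three second moments, each a sum over pairs of circles. For circles with \<open>i\<close> common
  points they contribute \<open>i * (i - 1)\<close>, \<open>i\<close> and \<open>1\<close>, combined
  as \<open>i * (i - 1) - 2 * i + 1\<close>.\<close>

lemma sum_defect_sq:
  defines "\<kappa> \<equiv> q * (q + 1) * (q\<^sup>2 - 1)"
  shows "(\<Sum>a\<in>\<Omega>. \<Sum>c\<in>\<Omega> - {a}. \<Sum>b\<in>\<Omega>. \<Sum>d\<in>\<Omega> - {b}. (defect a b c d)\<^sup>2)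
    = \<kappa>\<^sup>2 * (\<Sum>C\<in>F. \<Sum>D\<in>F. (int (card (C \<inter> D)))\<^sup>2 - 3 * int (card (C \<inter> D)) + 1)"
proof -
  let ?n = "int (card F)"
  let ?N = "\<lambda>a b. deg F (a, b)"
  define T where "T = (\<Sum>a\<in>\<Omega>. \<Sum>c\<in>\<Omega> - {a}. \<Sum>b\<in>\<Omega>. \<Sum>d\<in>\<Omega> - {b}. (codeg F (a, b) (c, d))\<^sup>2)"
  define Q where "Q = (\<Sum>a\<in>\<Omega>. \<Sum>b\<in>\<Omega>. (?N a b)\<^sup>2)"
  define R where "R = (\<Sum>a\<in>\<Omega>. \<Sum>c\<in>\<Omega> - {a}. \<Sum>b\<in>\<Omega>. ?N a b * (q * cdeg (a, b) + cdeg (c, b)))"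
  have "R = (\<Sum>a\<in>\<Omega>. \<Sum>b\<in>\<Omega>. \<Sum>c\<in>\<Omega> - {a}. ?N a b * (q * cdeg (a, b) + cdeg (c, b)))"
    unfolding R_def by (subst (2) sum.swap) simp
  also have "\<dots> = (\<Sum>a\<in>\<Omega>. \<Sum>b\<in>\<Omega>. (q\<^sup>2 - 1) * ((q + 1) * (?N a b)\<^sup>2 - ?n * ?N a b))"
  proof (intro sum.cong refl)
    fix a b assume ab: "a \<in> \<Omega>" "b \<in> \<Omega>"
    have "(\<Sum>c\<in>\<Omega> - {a}. ?N a b * (q * cdeg (a, b) + cdeg (c, b)))
      = ?N a b * (q * (q * cdeg (a, b)) + (\<Sum>c\<in>\<Omega> - {a}. cdeg (c, b)))"
      using card_remove_\<Omega>[OF ab(1)]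
      by (simp add: sum.distrib flip: sum_distrib_left del: card_Diff_singleton card_Diff_insert)
    also have "\<dots> = (q\<^sup>2 - 1) * ((q + 1) * (?N a b)\<^sup>2 - ?n * ?N a b)"
      unfolding sum_cdeg_col_remove[OF ab] by (simp add: cdeg_def power2_eq_square algebra_simps)
    finally show "(\<Sum>c\<in>\<Omega> - {a}. ?N a b * (q * cdeg (a, b) + cdeg (c, b))) = \<dots>" .
  qed
  also have "\<dots> = (q\<^sup>2 - 1) * ((q + 1) * Q - ?n * (\<Sum>a\<in>\<Omega>. \<Sum>b\<in>\<Omega>. ?N a b))"
    by (simp add: Q_def sum_subtractf flip: sum_distrib_left)
  also have "(\<Sum>a\<in>\<Omega>. \<Sum>b\<in>\<Omega>. ?N a b) = (q + 1) * ?n"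
    using sum_deg_row[OF F] card_\<Omega> by simp
  finally have R: "R = (q\<^sup>2 - 1) * ((q + 1) * Q - ?n * ((q + 1) * ?n))" .
  have "(\<Sum>a\<in>\<Omega>. \<Sum>c\<in>\<Omega> - {a}. \<Sum>b\<in>\<Omega>. \<Sum>d\<in>\<Omega> - {b}. (defect a b c d)\<^sup>2)
    = (\<Sum>a\<in>\<Omega>. \<Sum>c\<in>\<Omega> - {a}. \<kappa> * (\<kappa> * (\<Sum>b\<in>\<Omega>. \<Sum>d\<in>\<Omega> - {b}. (codeg F (a, b) (c, d))\<^sup>2)
        - (q\<^sup>2 - 1) * ?n\<^sup>2
        - q * (\<Sum>b\<in>\<Omega>. ?N a b * (q * cdeg (a, b) + cdeg (c, b)))
        - q * (\<Sum>d\<in>\<Omega>. ?N c d * (q * cdeg (c, d) + cdeg (a, d)))))"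
    unfolding \<kappa>_def by (intro sum.cong refl sum_defect_sq_fixed) auto
  also have "\<dots> = \<kappa> * (\<kappa> * T - (\<Sum>a\<in>\<Omega>. \<Sum>c\<in>\<Omega> - {a}. (q\<^sup>2 - 1) * ?n\<^sup>2) - q * R
      - q * (\<Sum>a\<in>\<Omega>. \<Sum>c\<in>\<Omega> - {a}. \<Sum>d\<in>\<Omega>. ?N c d * (q * cdeg (c, d) + cdeg (a, d))))"
    unfolding T_def R_def by (simp only: sum_subtractf flip: sum_distrib_left)
  also have "(\<Sum>a\<in>\<Omega>. \<Sum>c\<in>\<Omega> - {a}. \<Sum>d\<in>\<Omega>. ?N c d * (q * cdeg (c, d) + cdeg (a, d))) = R"
    unfolding R_def by (subst offdiag_swap) simp
  also have "(\<Sum>a\<in>\<Omega>. \<Sum>c\<in>\<Omega> - {a}. (q\<^sup>2 - 1) * ?n\<^sup>2) = (q + 1) * (q * ((q\<^sup>2 - 1) * ?n\<^sup>2))"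
    using card_remove_\<Omega> card_\<Omega> by (simp del: card_Diff_singleton card_Diff_insert)
  also have "\<kappa> * (\<kappa> * T - (q + 1) * (q * ((q\<^sup>2 - 1) * ?n\<^sup>2)) - q * R - q * R)
     = \<kappa>\<^sup>2 * (T - 2 * Q + ?n\<^sup>2)"
    unfolding R \<kappa>_def by (simp add: power2_eq_square algebra_simps)
  also have "T - 2 * Q + ?n\<^sup>2 = (\<Sum>C\<in>F. \<Sum>D\<in>F. (int (card (C \<inter> D)))\<^sup>2 - 3 * int (card (C \<inter> D)) + 1)"
    unfolding T_def Q_def sum_codeg_sq sum_deg_sq
    by (simp add: sum_subtractf sum.distrib power2_eq_square algebra_simps flip: sum_distrib_left)
  finally show ?thesis .
qed

text \<open>The polynomial \<open>i\<^sup>2 - 3 * i + 1\<close> equals \<open>-1\<close> both at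
  \<open>i = 1\<close> and at \<open>i = 2\<close>, the only values for distinct intersecting
  circles. For equal circles \<open>i = q + 1\<close> and the value is
  \<open>q * (q - 1) - 1\<close>.\<close>

lemma sum_defect_sq_intersecting:
  assumes int: "\<And>C D. C \<in> F \<Longrightarrow> D \<in> F \<Longrightarrow> C \<inter> D \<noteq> {}"
  shows "(\<Sum>a\<in>\<Omega>. \<Sum>c\<in>\<Omega> - {a}. \<Sum>b\<in>\<Omega>. \<Sum>d\<in>\<Omega> - {b}. (defect a b c d)\<^sup>2)
    = (q * (q + 1) * (q\<^sup>2 - 1))\<^sup>2 * (int (card F) * (q * (q - 1) - int (card F)))"
proof -
  have fF: "finite F" using F finite_circles finite_subset by blast
  have "(\<Sum>D\<in>F. (int (card (C \<inter> D)))\<^sup>2 - 3 * int (card (C \<inter> D)) + 1) = q * (q - 1) - int (card F)"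
    if C: "C \<in> F" for C
  proof -
    have "(\<Sum>D\<in>F. (int (card (C \<inter> D)))\<^sup>2 - 3 * int (card (C \<inter> D)) + 1)
      = (\<Sum>D\<in>F. (if D = C then q * (q - 1) else 0) - 1)"
    proof (intro sum.cong refl)
      fix D assume D: "D \<in> F"
      show "(int (card (C \<inter> D)))\<^sup>2 - 3 * int (card (C \<inter> D)) + 1 = (if D = C then q * (q - 1) else 0) - 1"
      proof (cases "D = C")
        case True
        then show ?thesis using card_circle C F by (auto simp: power2_eq_square algebra_simps)
      next
        case False
        then have "card (C \<inter> D) \<le> 2" using card_inter_circles C D F by blast
        moreover have "card (C \<inter> D) \<noteq> 0"
          using int[OF C D] C F finite_circle[of C] by (simp add: subset_iff)
        ultimately have "card (C \<inter> D) = 1 \<or> card (C \<inter> D) = 2" by linarith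
        then show ?thesis using False by auto
      qed
    qed
    then show ?thesis using C fF by (simp add: sum_subtractf)
  qed
  then show ?thesis unfolding sum_defect_sq by simp
qed

end

end

section \<open>Touching circles\<close>

context minkowski_plane
begin

lemma card_remove2_\<Omega>: "a \<in> \<Omega> \<Longrightarrow> c \<in> \<Omega> \<Longrightarrow> a \<noteq> c \<Longrightarrow> int (card (\<Omega> - {a, c})) = q - 1"
proof -
  assume "a \<in> \<Omega>" "c \<in> \<Omega>" "a \<noteq> c"
  then have "Suc (card (\<Omega> - {a} - {c})) = card (\<Omega> - {a})"
    using finite_\<Omega> by (intro card_Suc_Diff1) auto
  moreover have "\<Omega> - {a} - {c} = \<Omega> - {a, c}" by auto
  ultimately have "Suc (card (\<Omega> - {a, c})) = card (\<Omega> - {a})" by simp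
  then show ?thesis using card_remove_\<Omega>[OF \<open>a \<in> \<Omega>\<close>] by linarith
qed

lemma remove_nonempty: "a \<in> \<Omega> \<Longrightarrow> \<exists>c\<in>\<Omega>. a \<noteq> c"
proof -
  assume "a \<in> \<Omega>"
  then have "\<Omega> - {a} \<noteq> {}" using card_remove_\<Omega> q_ge_2 by (metis card.empty of_nat_0 not_numeral_le_zero)
  then show ?thesis by auto
qed

section \<open>Numbers of circles of the whole plane through given points\<close>

lemma count_three_points:
  assumes "{a, c, e} \<subseteq> \<Omega>" "distinct [a, c, e]" "{b, d, f} \<subseteq> \<Omega>" "distinct [b, d, f]"
  shows "(\<Sum>C\<in>\<C>. of_bool ((a, b) \<in> C) * of_bool ((c, d) \<in> C) * of_bool ((e, f) \<in> C)) = (1::int)"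
proof -
  obtain C where "\<C> \<inter> {C. (a, b) \<in> C \<and> (c, d) \<in> C \<and> (e, f) \<in> C} = {C}"
    using circle_three_points[OF assms] by blast
  then show ?thesis using finite_circles by (simp add: conj_ac flip: of_bool_conj)
qed

text \<open>A third first coordinate \<open>e\<close> classifies the circles through the two points
  by their point over \<open>e\<close>: its second coordinate has \<open>q - 1\<close> possible
  values, each giving one circle.\<close>

lemma codeg_circles:
  assumes in\<Omega>: "a \<in> \<Omega>" "b \<in> \<Omega>" "c \<in> \<Omega>" "d \<in> \<Omega>" and ne: "a \<noteq> c" "b \<noteq> d"
  shows "codeg \<C> (a, b) (c, d) = q - 1"
proof -
  have "\<Omega> - {a, c} \<noteq> {}"
  proof
    assume "\<Omega> - {a, c} = {}"
    then have "int (card (\<Omega> - {a, c})) = 0" by (simp only: card.empty of_nat_0)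
    then show False using card_remove2_\<Omega>[OF in\<Omega>(1,3) ne(1)] q_ge_2 by linarith
  qed
  then obtain e where e: "e \<in> \<Omega>" "e \<noteq> a" "e \<noteq> c" by auto
  have one: "(\<Sum>f\<in>\<Omega> - {b, d}. of_bool ((e, f) \<in> C)) = (1::int)"
    if C: "C \<in> \<C>" "(a, b) \<in> C" "(c, d) \<in> C" for C
  proof -
    have "(e, b) \<notin> C" "(e, d) \<notin> C" using circle_snd_eq C e by blast+
    then have "(\<Sum>f\<in>\<Omega> - {b, d}. of_bool ((e, f) \<in> C)) = (\<Sum>f\<in>\<Omega>. of_bool ((e, f) \<in> C) :: int)"
      using finite_\<Omega> by (intro sum.mono_neutral_left) auto
    then show ?thesis using sum_row C e by simp
  qed
  have "codeg \<C> (a, b) (c, d) = (\<Sum>C\<in>\<C>. of_bool ((a, b) \<in> C) * of_bool ((c, d) \<in> C)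
      * (\<Sum>f\<in>\<Omega> - {b, d}. of_bool ((e, f) \<in> C)))"
    unfolding codeg_def by (intro sum.cong refl) (auto simp: one simp del: sum_of_bool_eq)
  also have "\<dots> = (\<Sum>f\<in>\<Omega> - {b, d}. \<Sum>C\<in>\<C>.
      of_bool ((a, b) \<in> C) * of_bool ((c, d) \<in> C) * of_bool ((e, f) \<in> C))"
    unfolding sum_distrib_left by (rule sum.swap)
  also have "\<dots> = (\<Sum>f\<in>\<Omega> - {b, d}. 1)"
    using in\<Omega> ne e by (intro sum.cong refl count_three_points) auto
  finally show ?thesis using card_remove2_\<Omega>[OF in\<Omega>(2,4) ne(2)] by simp
qed

lemma deg_circles:
  assumes "a \<in> \<Omega>" "b \<in> \<Omega>"
  shows "deg \<C> (a, b) = q * (q - 1)"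
proof -
  obtain c where c: "c \<in> \<Omega>" "a \<noteq> c" using remove_nonempty assms by blast
  have "deg \<C> (a, b) = (\<Sum>d\<in>\<Omega> - {b}. codeg \<C> (a, b) (c, d))"
    using sum_codeg_row[of \<C> c a b] c by simp
  also have "\<dots> = (\<Sum>d\<in>\<Omega> - {b}. q - 1)"
    using assms c by (intro sum.cong refl codeg_circles) auto
  finally show ?thesis using card_remove_\<Omega>[OF assms(2)] by simp
qed

section \<open>Counting touching members of a family\<close>

lemma deg_nonneg: "0 \<le> deg F p" and touch_nonneg: "0 \<le> touch F p C"
  by (simp_all add: deg_def touch_def sum_nonneg)

lemma codeg_mono: "F \<subseteq> \<C> \<Longrightarrow> codeg F p p' \<le> codeg \<C> p p'"
  unfolding codeg_def using finite_circles by (intro sum_mono2) auto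

lemma touch_mono: "F \<subseteq> \<C> \<Longrightarrow> touch F p C \<le> touch \<C> p C"
  unfolding touch_def using finite_circles by (intro sum_mono2) auto

text \<open>A member through \<open>p\<close> has \<open>q\<close> further points on
  \<open>C\<close> if it equals \<open>C\<close>, none if it touches \<open>C\<close> at
  \<open>p\<close>, and one otherwise. The coefficient of \<open>of_bool (C \<in> F)\<close> is
  \<open>q\<close> because \<open>touch\<close> already cancels the contribution of \<open>C\<close>
  to \<open>deg F p\<close>.\<close>

lemma sum_codeg_circle:
  assumes F: "F \<subseteq> \<C>" and C: "C \<in> \<C>" and p: "p \<in> C"
  shows "(\<Sum>p'\<in>C - {p}. codeg F p p') = q * of_bool (C \<in> F) + deg F p - touch F p C"
proof -
  have fF: "finite F" using F finite_circles finite_subset by blast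
  have "(\<Sum>p'\<in>C - {p}. codeg F p p')
      = (\<Sum>D\<in>F. of_bool (p \<in> D) * (\<Sum>p'\<in>C - {p}. of_bool (p' \<in> D)))"
    unfolding codeg_def sum_distrib_left by (rule sum.swap)
  also have "\<dots> = (\<Sum>D\<in>F. q * of_bool (D = C) + of_bool (p \<in> D)
      - of_bool (p \<in> D) * of_bool (D = C \<or> D \<inter> C = {p}))"
  proof (intro sum.cong refl)
    fix D assume D: "D \<in> F"
    then have D': "D \<in> \<C>" using F by blast
    show "of_bool (p \<in> D) * (\<Sum>p'\<in>C - {p}. of_bool (p' \<in> D))
      = q * of_bool (D = C) + of_bool (p \<in> D) - of_bool (p \<in> D) * of_bool (D = C \<or> D \<inter> C = {p})"
    proof (cases "p \<in> D")
      case True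
      have fin: "finite (C \<inter> D)" using finite_circle[OF C] by simp
      have "(C - {p}) \<inter> {x. x \<in> D} = C \<inter> D - {p}" by auto
      then have sum: "(\<Sum>p'\<in>C - {p}. of_bool (p' \<in> D)) = int (card (C \<inter> D - {p}))"
        using finite_circle[OF C] by simp
      have card: "int (card (C \<inter> D - {p})) = int (card (C \<inter> D)) - 1"
        using card_Suc_Diff1[OF fin, of p] True p by simp
      consider "D = C" | "D \<noteq> C" "D \<inter> C = {p}" | "D \<noteq> C" "D \<inter> C \<noteq> {p}" by blast
      then show ?thesis
      proof cases
        case 1
        then show ?thesis using sum card card_circle[OF C] True by simp
      next
        case 2
        then show ?thesis using sum True by (simp add: Int_commute)
      next
        case 3
        have "C \<inter> D - {p} \<noteq> {}" using 3 True p by blast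
        then have "card (C \<inter> D - {p}) \<noteq> 0" using fin by simp
        moreover have "card (C \<inter> D) \<le> 2" using card_inter_circles[OF C D'] 3 by simp
        ultimately have "int (card (C \<inter> D - {p})) = 1" using card by linarith
        then show ?thesis using 3 sum True by simp
      qed
    qed (use p in auto)
  qed
  also have "\<dots> = q * (\<Sum>D\<in>F. of_bool (D = C)) + deg F p - touch F p C"
    by (simp only: sum.distrib sum_subtractf deg_def touch_def flip: sum_distrib_left)
  also have "(\<Sum>D\<in>F. of_bool (D = C)) = (of_bool (C \<in> F) :: int)"
    using fF by (simp add: of_bool_def)
  finally show ?thesis .
qed

text \<open>This is \<open>sum_codeg_circle\<close> for the family of all circles, where the other
  terms are known.\<close>

lemma touch_circles:
  assumes C: "C \<in> \<C>" and p: "p \<in> C"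
  shows "touch \<C> p C = q"
proof -
  obtain a b where p': "p = (a, b)" by fastforce
  have ab: "a \<in> \<Omega>" "b \<in> \<Omega>" using circle_subset[OF C] p p' by auto
  have "(\<Sum>x\<in>C - {p}. codeg \<C> p x) = (\<Sum>x\<in>C - {p}. q - 1)"
  proof (intro sum.cong refl)
    fix x assume x: "x \<in> C - {p}"
    obtain c d where x': "x = (c, d)" by fastforce
    have "a \<noteq> c" "b \<noteq> d"
      using x x' p p' circle_fst_eq[OF C] circle_snd_eq[OF C] by auto
    then show "codeg \<C> p x = q - 1"
      using codeg_circles[of a b c d] ab x x' p' circle_subset[OF C] by auto
  qed
  also have "\<dots> = q * (q - 1)"
    using card_Suc_Diff1[OF finite_circle[OF C] p] card_circle[OF C] by simp
  finally show ?thesis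
    using sum_codeg_circle[OF _ C p, of \<C>] deg_circles[OF ab] C p' by simp
qed

lemma touch_le:
  assumes F: "F \<subseteq> \<C>" and C: "C \<in> \<C>" and p: "p \<in> C"
  shows "touch F p C \<le> q" and "C \<notin> F \<Longrightarrow> touch F p C \<le> q - 1" and "C \<in> F \<Longrightarrow> 1 \<le> touch F p C"
proof -
  have fF: "finite F" using F finite_circles finite_subset by blast
  show "touch F p C \<le> q" using touch_mono[OF F] touch_circles[OF C p] by metis
  show "touch F p C \<le> q - 1" if "C \<notin> F"
  proof -
    have "touch (insert C F) p C = 1 + touch F p C"
      using that fF p by (simp add: touch_def)
    then show ?thesis using touch_mono[of "insert C F" p C] F C touch_circles[OF C p] by simp
  qed
  show "1 \<le> touch F p C" if "C \<in> F"
  proof -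
    have "touch {C} p C \<le> touch F p C"
      unfolding touch_def using that fF by (intro sum_mono2) auto
    then show ?thesis using p by (simp add: touch_def)
  qed
qed

text \<open>Touching at \<open>p\<close> is symmetric, so the pairs can be counted from the side of
  the member of \<open>F\<close>, which is touched by \<open>q\<close> circles, itself
  included.\<close>

lemma sum_touch:
  assumes F: "F \<subseteq> \<C>"
  shows "(\<Sum>C\<in>\<C>. of_bool (p \<in> C) * touch F p C) = q * deg F p"
proof -
  have "(\<Sum>C\<in>\<C>. of_bool (p \<in> C) * touch F p C)
    = (\<Sum>D\<in>F. \<Sum>C\<in>\<C>. of_bool (p \<in> C) * (of_bool (p \<in> D) * of_bool (D = C \<or> D \<inter> C = {p})))"
    unfolding touch_def sum_distrib_left by (rule sum.swap)
  also have "\<dots> = (\<Sum>D\<in>F. of_bool (p \<in> D) * touch \<C> p D)"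
    unfolding touch_def sum_distrib_left
    by (intro sum.cong refl) (auto simp: Int_commute)
  also have "\<dots> = (\<Sum>D\<in>F. q * of_bool (p \<in> D))"
  proof (intro sum.cong refl)
    fix D assume "D \<in> F"
    then show "of_bool (p \<in> D) * touch \<C> p D = q * of_bool (p \<in> D)"
      using F touch_circles[of D p] by auto
  qed
  finally show ?thesis by (simp only: deg_def sum_distrib_left)
qed

text \<open>By the hypothesis on \<open>touch\<close>, the weight \<open>codeg F (a, b)\<close> has
  the same total \<open>deg F (a, b)\<close> on every circle through \<open>(a, b)\<close>, as it
  has on rows and columns. These are the lines of the affine plane derived at \<open>(a, b)\<close>,
  and a weight with constant line sums is constant. Concretely, the totals are added over the
  \<open>q - 1\<close> circles through both points.\<close>

lemma deg_eq_mult_codeg: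
  assumes F: "F \<subseteq> \<C>" and in\<Omega>: "a \<in> \<Omega>" "b \<in> \<Omega>" "c \<in> \<Omega>" "d \<in> \<Omega>" and ne: "a \<noteq> c" "b \<noteq> d"
    and touch: "\<And>E. E \<in> \<C> \<Longrightarrow> (a, b) \<in> E \<Longrightarrow> touch F (a, b) E = q * of_bool (E \<in> F)"
  shows "deg F (a, b) = q * codeg F (a, b) (c, d)"
proof -
  let ?p = "(a, b)" and ?p' = "(c, d)"
  let ?g = "codeg F ?p"
  let ?i = "\<lambda>E. of_bool (?p \<in> E) * of_bool (?p' \<in> E) :: int"
  have "(q - 1) * deg F ?p = (\<Sum>E\<in>\<C>. ?i E * deg F ?p)"
    using codeg_circles[OF in\<Omega> ne] by (simp only: codeg_def flip: sum_distrib_right)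
  also have "\<dots> = (\<Sum>E\<in>\<C>. ?i E * ?g ?p' +
      (\<Sum>e\<in>\<Omega> - {a, c}. \<Sum>h\<in>\<Omega> - {b, d}. ?i E * of_bool ((e, h) \<in> E) * ?g (e, h)))"
  proof (intro sum.cong refl)
    fix E assume E: "E \<in> \<C>"
    show "?i E * deg F ?p = ?i E * ?g ?p' +
      (\<Sum>e\<in>\<Omega> - {a, c}. \<Sum>h\<in>\<Omega> - {b, d}. ?i E * of_bool ((e, h) \<in> E) * ?g (e, h))"
    proof (cases "?p \<in> E \<and> ?p' \<in> E")
      case True
      have "E \<inter> (\<Omega> - {a, c}) \<times> (\<Omega> - {b, d}) = E - {?p} - {?p'}"
      proof -
        have *: "e \<in> \<Omega> \<and> h \<in> \<Omega> \<and> e \<noteq> a \<and> e \<noteq> c \<and> h \<noteq> b \<and> h \<noteq> d"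
          if "(e, h) \<in> E" "(e, h) \<noteq> ?p" "(e, h) \<noteq> ?p'" for e h
        proof -
          have "e \<noteq> a" using that True circle_fst_eq[OF E, of a h b] by blast
          moreover have "e \<noteq> c" using that True circle_fst_eq[OF E, of c h d] by blast
          moreover have "h \<noteq> b" using that True circle_snd_eq[OF E, of e b a] by blast
          moreover have "h \<noteq> d" using that True circle_snd_eq[OF E, of e d c] by blast
          ultimately show ?thesis using that circle_subset[OF E] by blast
        qed
        show ?thesis
        proof (intro equalityI subrelI)
          fix e h assume "(e, h) \<in> E - {?p} - {?p'}"
          then show "(e, h) \<in> E \<inter> (\<Omega> - {a, c}) \<times> (\<Omega> - {b, d})" using *[of e h] by simp
        qed simp
      qed
      then have "(\<Sum>e\<in>\<Omega> - {a, c}. \<Sum>h\<in>\<Omega> - {b, d}. of_bool ((e, h) \<in> E) * ?g (e, h))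
        = sum ?g (E - {?p} - {?p'})"
        using sum_rect[of "\<Omega> - {a, c}" "\<Omega> - {b, d}" E ?g] finite_\<Omega> by simp
      moreover have "sum ?g (E - {?p}) = ?g ?p' + sum ?g (E - {?p} - {?p'})"
        using True ne finite_circle[OF E] by (intro sum.remove) auto
      moreover have "sum ?g (E - {?p}) = deg F ?p"
        using sum_codeg_circle[OF F E] True touch[OF E] by simp
      ultimately show ?thesis using True by simp
    next
      case False
      then have "?i E = 0" by auto
      then show ?thesis by simp
    qed
  qed
  also have "\<dots> = (q - 1) * ?g ?p' +
      (\<Sum>E\<in>\<C>. \<Sum>e\<in>\<Omega> - {a, c}. \<Sum>h\<in>\<Omega> - {b, d}. ?i E * of_bool ((e, h) \<in> E) * ?g (e, h))"
    unfolding sum.distrib using codeg_circles[OF in\<Omega> ne] by (simp only: codeg_def flip: sum_distrib_right)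
  also have "(\<Sum>E\<in>\<C>. \<Sum>e\<in>\<Omega> - {a, c}. \<Sum>h\<in>\<Omega> - {b, d}. ?i E * of_bool ((e, h) \<in> E) * ?g (e, h))
    = (\<Sum>e\<in>\<Omega> - {a, c}. \<Sum>h\<in>\<Omega> - {b, d}. (\<Sum>E\<in>\<C>. ?i E * of_bool ((e, h) \<in> E)) * ?g (e, h))"
    unfolding sum_distrib_right
    by (subst sum.swap, rule sum.cong[OF refl], rule sum.swap)
  \<comment> \<open>Each point in this range lies on exactly one circle through the two given
    points.\<close>
  also have "\<dots> = (\<Sum>e\<in>\<Omega> - {a, c}. \<Sum>h\<in>\<Omega> - {b, d}. ?g (e, h))"
    using in\<Omega> ne by (intro sum.cong refl) (subst count_three_points; auto)
  also have "\<dots> = (\<Sum>e\<in>\<Omega> - {a, c}. deg F ?p - ?g (e, d))"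
  proof (intro sum.cong refl)
    fix e assume e: "e \<in> \<Omega> - {a, c}"
    have "(\<Sum>h\<in>\<Omega> - {b}. ?g (e, h)) = deg F ?p" using sum_codeg_row[OF F, of e a b] e by auto
    moreover have "(\<Sum>h\<in>\<Omega> - {b}. ?g (e, h)) = ?g (e, d) + (\<Sum>h\<in>\<Omega> - {b} - {d}. ?g (e, h))"
      using in\<Omega> ne finite_\<Omega> by (intro sum.remove) auto
    moreover have "\<Omega> - {b} - {d} = \<Omega> - {b, d}" by auto
    ultimately show "(\<Sum>h\<in>\<Omega> - {b, d}. ?g (e, h)) = deg F ?p - ?g (e, d)" by simp
  qed
  also have "\<dots> = (q - 1) * deg F ?p - (deg F ?p - ?g ?p')"
  proof -
    have "(\<Sum>e\<in>\<Omega> - {a}. ?g (e, d)) = deg F ?p" using sum_codeg_col[OF F, of d b a] in\<Omega> ne by simp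
    moreover have "(\<Sum>e\<in>\<Omega> - {a}. ?g (e, d)) = ?g (c, d) + (\<Sum>e\<in>\<Omega> - {a} - {c}. ?g (e, d))"
      using in\<Omega> ne finite_\<Omega> by (intro sum.remove) auto
    moreover have "\<Omega> - {a} - {c} = \<Omega> - {a, c}" by auto
    ultimately show ?thesis
      using card_remove2_\<Omega>[OF in\<Omega>(1,3) ne(1)] by (simp add: sum_subtractf del: card_Diff_insert)
  qed
  finally show ?thesis by (simp add: algebra_simps)
qed

end

section \<open>The extremal families\<close>

context minkowski_plane
begin

section \<open>The bound and the vanishing of the defect in case of equality\<close>

lemma sq_minus_1_pos: "0 < q\<^sup>2 - 1"
proof -
  have "q\<^sup>2 - 1 = (q - 1) * (q + 1)" by (simp add: power2_eq_square algebra_simps)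
  then show ?thesis using q_ge_2 by simp
qed

lemma intersecting_card_le:
  assumes F: "F \<subseteq> \<C>" and int: "\<And>C D. C \<in> F \<Longrightarrow> D \<in> F \<Longrightarrow> C \<inter> D \<noteq> {}"
  shows "int (card F) \<le> q * (q - 1)"
proof (rule ccontr)
  assume neg: "\<not> ?thesis"
  moreover have "0 \<le> q * (q - 1)" using q_ge_2 by simp
  ultimately have "int (card F) * (q * (q - 1) - int (card F)) < 0"
    by (intro mult_pos_neg) linarith+
  moreover have "0 < (q * (q + 1) * (q\<^sup>2 - 1))\<^sup>2"
    using q_ge_2 sq_minus_1_pos by (intro zero_less_power mult_pos_pos) auto
  ultimately have "(q * (q + 1) * (q\<^sup>2 - 1))\<^sup>2 * (int (card F) * (q * (q - 1) - int (card F))) < 0"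
    by (rule mult_pos_neg[rotated])
  moreover have "0 \<le> (\<Sum>a\<in>\<Omega>. \<Sum>c\<in>\<Omega> - {a}. \<Sum>b\<in>\<Omega>. \<Sum>d\<in>\<Omega> - {b}. (defect F a b c d)\<^sup>2)"
    by (intro sum_nonneg) simp
  ultimately show False
    using sum_defect_sq_intersecting[OF F int] by linarith
qed

text \<open>Equality makes a sum of squares vanish, hence every defect. Once \<open>card F\<close>
  is substituted, the factor \<open>q * (q + 1)\<close> cancels.\<close>

lemma codeg_extremal:
  assumes F: "F \<subseteq> \<C>" and int: "\<And>C D. C \<in> F \<Longrightarrow> D \<in> F \<Longrightarrow> C \<inter> D \<noteq> {}"
    and card: "int (card F) = q * (q - 1)"
    and abcd: "a \<in> \<Omega>" "b \<in> \<Omega>" "c \<in> \<Omega>" "d \<in> \<Omega>" "a \<noteq> c" "b \<noteq> d"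
  shows "(q\<^sup>2 - 1) * (codeg F (a, b) (c, d) + 1)
    = q * (deg F (a, b) + deg F (c, d)) + deg F (a, d) + deg F (c, b)"
proof -
  have sum0: "(\<Sum>a\<in>\<Omega>. \<Sum>c\<in>\<Omega> - {a}. \<Sum>b\<in>\<Omega>. \<Sum>d\<in>\<Omega> - {b}. (defect F a b c d)\<^sup>2) = 0"
    using sum_defect_sq_intersecting[OF F int] card by simp
  have "(\<Sum>c\<in>\<Omega> - {a}. \<Sum>b\<in>\<Omega>. \<Sum>d\<in>\<Omega> - {b}. (defect F a b c d)\<^sup>2) = 0"
    using sum0 abcd(1) finite_\<Omega> by (subst (asm) sum_nonneg_eq_0_iff) (auto simp: sum_nonneg)
  then have "(\<Sum>b\<in>\<Omega>. \<Sum>d\<in>\<Omega> - {b}. (defect F a b c d)\<^sup>2) = 0"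
    using abcd(3,5) finite_\<Omega> by (subst (asm) sum_nonneg_eq_0_iff) (auto simp: sum_nonneg)
  then have "(\<Sum>d\<in>\<Omega> - {b}. (defect F a b c d)\<^sup>2) = 0"
    using abcd(2) finite_\<Omega> by (subst (asm) sum_nonneg_eq_0_iff) (auto simp: sum_nonneg)
  then have "(defect F a b c d)\<^sup>2 = 0"
    using abcd(4,6) finite_\<Omega> by (subst (asm) sum_nonneg_eq_0_iff) auto
  then have "defect F a b c d = 0" by simp
  then have "(q * (q + 1)) * ((q\<^sup>2 - 1) * (codeg F (a, b) (c, d) + 1))
    = (q * (q + 1)) * (q * (deg F (a, b) + deg F (c, d)) + deg F (a, d) + deg F (c, b))"
    unfolding defect_def[OF F] cdeg_def[OF F] card by (simp add: power2_eq_square algebra_simps)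
  moreover have "q * (q + 1) \<noteq> 0" using q_ge_2 by simp
  ultimately show ?thesis by (subst (asm) mult_left_cancel)
qed

section \<open>Touching numbers in case of equality\<close>

context
  fixes F :: "('p \<times> 'p) set set"
  assumes F: "F \<subseteq> \<C>"
    and card_F: "int (card F) = q * (q - 1)"
    and codeg_eq: "\<And>a b c d. \<lbrakk>a \<in> \<Omega>; b \<in> \<Omega>; c \<in> \<Omega>; d \<in> \<Omega>; a \<noteq> c; b \<noteq> d\<rbrakk> \<Longrightarrow>
      (q\<^sup>2 - 1) * (codeg F (a, b) (c, d) + 1)
        = q * (deg F (a, b) + deg F (c, d)) + deg F (a, d) + deg F (c, b)"
begin

text \<open>The relation for \<open>codeg F\<close> is summed over the points \<open>x\<close> of
  \<open>C\<close> other than \<open>p\<close> and compared with \<open>sum_codeg_circle\<close>. As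
  \<open>x\<close> runs through \<open>C\<close>, the points \<open>(a, snd x)\<close> and
  \<open>(fst x, b)\<close> run through a whole row and a whole column, whose degree sums are
  \<open>card F\<close>.\<close>

lemma touch_formula:
  assumes C: "C \<in> \<C>" and p: "p \<in> C"
  shows "(q\<^sup>2 - 1) * touch F p C
    = q * ((q\<^sup>2 - 1) * of_bool (C \<in> F) - (\<Sum>p\<in>C. deg F p))
      + (q + 1) * deg F p + q * (q\<^sup>2 - 1) - 2 * q * (q - 1)"
proof -
  obtain a b where p': "p = (a, b)" by fastforce
  have ab: "a \<in> \<Omega>" "b \<in> \<Omega>" using circle_subset[OF C] p p' by auto
  have fC: "finite C" using C by (rule finite_circle)
  have card: "int (card (C - {p})) = q"
    using card_Suc_Diff1[OF fC p] card_circle[OF C] by simp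
  have mem: "fst x \<in> \<Omega>" "snd x \<in> \<Omega>" "a \<noteq> fst x" "b \<noteq> snd x" if "x \<in> C - {p}" for x
  proof -
    obtain c d where x: "x = (c, d)" by fastforce
    have "(c, d) \<in> C" "(a, b) \<in> C" "(c, d) \<noteq> (a, b)" using that p p' x by auto
    moreover from this have "c \<in> \<Omega>" "d \<in> \<Omega>" using circle_subset[OF C] by blast+
    moreover from calculation have "a \<noteq> c" "b \<noteq> d"
      using circle_fst_eq[OF C] circle_snd_eq[OF C] by blast+
    ultimately show "fst x \<in> \<Omega>" "snd x \<in> \<Omega>" "a \<noteq> fst x" "b \<noteq> snd x"
      using x by simp_all
  qed
  have eq: "(q\<^sup>2 - 1) * codeg F p x
      = q * deg F p + q * deg F x + deg F (a, snd x) + deg F (fst x, b) - (q\<^sup>2 - 1)"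
    if "x \<in> C - {p}" for x
    using codeg_eq[OF ab mem[OF that]] p' by (simp add: algebra_simps)
  have snd: "(\<Sum>x\<in>C - {p}. deg F (a, snd x)) = q * (q - 1) - deg F p"
  proof -
    have "(\<Sum>x\<in>C. deg F (a, snd x)) = q * (q - 1)"
      using sum.reindex_bij_betw[OF bij_betw_snd_circle[OF C], of "\<lambda>b. deg F (a, b)"]
        sum_deg_row[OF F ab(1)] card_F by simp
    moreover have "deg F (a, snd p) = deg F p" using p' by simp
    ultimately show ?thesis using sum.remove[OF fC p, of "\<lambda>x. deg F (a, snd x)"] by linarith
  qed
  have fst: "(\<Sum>x\<in>C - {p}. deg F (fst x, b)) = q * (q - 1) - deg F p"
  proof -
    have "(\<Sum>x\<in>C. deg F (fst x, b)) = q * (q - 1)"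
      using sum.reindex_bij_betw[OF bij_betw_fst_circle[OF C], of "\<lambda>a. deg F (a, b)"]
        sum_deg_col[OF F ab(2)] card_F by simp
    moreover have "deg F (fst p, b) = deg F p" using p' by simp
    ultimately show ?thesis using sum.remove[OF fC p, of "\<lambda>x. deg F (fst x, b)"] by linarith
  qed
  have "(q\<^sup>2 - 1) * (q * of_bool (C \<in> F) + deg F p - touch F p C) = (\<Sum>x\<in>C - {p}. (q\<^sup>2 - 1) * codeg F p x)"
    using sum_codeg_circle[OF F C p] by (simp flip: sum_distrib_left)
  also have "\<dots> = (\<Sum>x\<in>C - {p}. q * deg F p + q * deg F x + deg F (a, snd x) + deg F (fst x, b) - (q\<^sup>2 - 1))"
    using eq by (intro sum.cong) auto
  also have "\<dots> = q * (q * deg F p) + q * ((\<Sum>p\<in>C. deg F p) - deg F p)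
     + 2 * (q * (q - 1) - deg F p) - q * (q\<^sup>2 - 1)"
    using fst snd sum.remove[OF fC p, of "deg F"] card
    by (simp add: sum.distrib sum_subtractf flip: sum_distrib_left del: card_Diff_singleton card_Diff_insert)
  finally show ?thesis by (simp add: power2_eq_square algebra_simps)
qed

text \<open>The terms that depend on \<open>p\<close> cancel. The right side is a quantity of
  \<open>C\<close> and \<open>D\<close> alone, so it takes the same value at every common point of
  the two circles.\<close>

lemma touch_diff:
  assumes "C \<in> \<C>" "p \<in> C" "D \<in> \<C>" "p \<in> D"
  shows "(q\<^sup>2 - 1) * (touch F p C - touch F p D)
    = q * (((q\<^sup>2 - 1) * of_bool (C \<in> F) - (\<Sum>p\<in>C. deg F p))
         - ((q\<^sup>2 - 1) * of_bool (D \<in> F) - (\<Sum>p\<in>D. deg F p)))"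
  using touch_formula[of C p] touch_formula[of D p] assms by (simp add: algebra_simps)

lemma touch_diff_dvd:
  assumes "C \<in> \<C>" "p \<in> C" "D \<in> \<C>" "p \<in> D"
  shows "q dvd touch F p C - touch F p D"
proof -
  let ?t = "touch F p C - touch F p D"
  have "q dvd (q\<^sup>2 - 1) * ?t" unfolding touch_diff[OF assms] by simp
  then have "q dvd q * (q * ?t) - (q\<^sup>2 - 1) * ?t" by (intro dvd_diff) auto
  \<comment> \<open>An explicit witness that \<open>q\<close> and \<open>q\<^sup>2 - 1\<close> are
    coprime.\<close>
  also have "q * (q * ?t) - (q\<^sup>2 - 1) * ?t = ?t" by (simp add: power2_eq_square algebra_simps)
  finally show ?thesis .
qed

text \<open>Touching numbers at \<open>p\<close> lie between \<open>0\<close> and \<open>q\<close>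
  and agree modulo \<open>q\<close>. If two differ, one of them is \<open>0\<close>, so all are
  \<open>0\<close> or \<open>q\<close>; membership in \<open>F\<close> excludes \<open>0\<close> and
  non-membership excludes \<open>q\<close>.\<close>

lemma touch_dichotomy:
  assumes C: "C \<in> \<C>" "p \<in> C" and D: "D \<in> \<C>" "p \<in> D"
    and ne: "touch F p C \<noteq> touch F p D" and E: "E \<in> \<C>" "p \<in> E"
  shows "touch F p E = q * of_bool (E \<in> F)"
proof -
  have bounds: "0 \<le> touch F p X" "touch F p X \<le> q" if "X \<in> \<C>" "p \<in> X" for X
    using touch_nonneg touch_le(1)[OF F that] by auto
  have zq: "X = 0 \<or> X = q" if "q dvd X" "0 \<le> X" "X \<le> q" for X :: int
    using that q_ge_2 zdvd_imp_le[of q X] by (cases "X = 0") auto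
  have "\<exists>Z. Z \<in> \<C> \<and> p \<in> Z \<and> touch F p Z = 0"
  proof (cases "touch F p C < touch F p D")
    case True
    have "q \<le> touch F p D - touch F p C"
      using touch_diff_dvd[OF D C] True by (intro zdvd_imp_le) auto
    then have "touch F p C = 0" using bounds[OF C] bounds[OF D] by linarith
    then show ?thesis using C by blast
  next
    case False
    then have "q \<le> touch F p C - touch F p D"
      using touch_diff_dvd[OF C D] ne by (intro zdvd_imp_le) auto
    then have "touch F p D = 0" using bounds[OF C] bounds[OF D] by linarith
    then show ?thesis using D by blast
  qed
  then obtain Z where Z: "Z \<in> \<C>" "p \<in> Z" "touch F p Z = 0" by blast
  have "q dvd touch F p E" using touch_diff_dvd[OF E Z(1,2)] Z(3) by simp
  then have "touch F p E = 0 \<or> touch F p E = q" using zq bounds[OF E] by blast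
  then show ?thesis
    using touch_le(2,3)[OF F E] q_ge_2 by (cases "E \<in> F") auto
qed

text \<open>If two circles through \<open>p\<close> had different touching numbers, each touching class at \<open>p\<close> would lie
  inside or outside \<open>F\<close>. By \<open>touch_diff\<close> the obstruction depends on the circles only, so it
  spreads to all points not collinear with \<open>p\<close>, and \<open>deg F\<close> becomes too large on a column.\<close>

lemma touch_const:
  assumes C: "C \<in> \<C>" "p \<in> C" and D: "D \<in> \<C>" "p \<in> D"
  shows "touch F p C = touch F p D"
proof (rule ccontr)
  assume ne: "touch F p C \<noteq> touch F p D"
  have fF: "finite F" using F finite_circles finite_subset by blast
  obtain a b where p': "p = (a, b)" by fastforce
  have ab: "a \<in> \<Omega>" "b \<in> \<Omega>" using circle_subset C p' by auto
  obtain c where c: "c \<in> \<Omega>" "a \<noteq> c" using remove_nonempty ab by blast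
  obtain d where d: "d \<in> \<Omega>" "b \<noteq> d" using remove_nonempty ab by blast
  note touch_p = touch_dichotomy[OF C D ne]
  have mult: "deg F (a, b) = q * codeg F (a, b) (x, d)" if x: "x \<in> \<Omega>" "a \<noteq> x" for x
    using deg_eq_mult_codeg[OF F ab x(1) d(1) x(2) d(2)] touch_p p' by blast
  \<comment> \<open>One of the two touching numbers is \<open>0\<close> and the other
    \<open>q\<close>, so \<open>p\<close> lies on a member of \<open>F\<close> and on a circle
    outside \<open>F\<close>.\<close>
  have CD: "C \<in> F \<longleftrightarrow> D \<notin> F"
    using ne touch_p[OF C] touch_p[OF D] by auto
  then have "{C \<in> F. p \<in> C} \<noteq> {}" "{C \<in> F. p \<in> C} \<subset> {C \<in> \<C>. p \<in> C}"
    using C D F by auto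
  then have "0 < deg F p" "deg F p < deg \<C> p"
    using fF finite_circles
    by (auto simp: deg_eq_card card_gt_0_iff intro!: psubset_card_mono simp del: of_nat_less_iff simp: of_nat_less_iff[where 'a=int])
  then have deg: "0 < deg F (a, b)" "deg F (a, b) < q * (q - 1)"
    using deg_circles[OF ab] p' by auto
  have deg_col: "deg F (x, d) = deg F (a, b)" if x: "x \<in> \<Omega>" "a \<noteq> x" for x
  proof -
    \<comment> \<open>The strict bounds provide both a member \<open>E\<close> and a non-member
      \<open>G\<close> through \<open>(a, b)\<close> and \<open>(x, d)\<close>; their unequal
      touching numbers carry over to \<open>(x, d)\<close>.\<close>
    have lt: "0 < codeg F (a, b) (x, d)" "codeg F (a, b) (x, d) < q - 1"
      using deg mult[OF x] q_ge_2 by (auto simp: zero_less_mult_iff)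
    have "{C \<in> F. (a, b) \<in> C \<and> (x, d) \<in> C} \<noteq> {}"
      using lt(1) by (auto simp: codeg_eq_card[OF fF] card_gt_0_iff)
    then obtain E where E: "E \<in> F" "(a, b) \<in> E" "(x, d) \<in> E" by blast
    have "{C \<in> F. (a, b) \<in> C \<and> (x, d) \<in> C} \<noteq> {C \<in> \<C>. (a, b) \<in> C \<and> (x, d) \<in> C}"
    proof
      assume "{C \<in> F. (a, b) \<in> C \<and> (x, d) \<in> C} = {C \<in> \<C>. (a, b) \<in> C \<and> (x, d) \<in> C}"
      then have "codeg F (a, b) (x, d) = codeg \<C> (a, b) (x, d)"
        unfolding codeg_eq_card[OF fF] codeg_eq_card[OF finite_circles] by (rule arg_cong)
      then show False using lt(2) codeg_circles[OF ab x(1) d(1) x(2) d(2)] by linarith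
    qed
    then obtain G where G: "G \<in> \<C>" "G \<notin> F" "(a, b) \<in> G" "(x, d) \<in> G" using F by blast
    have E': "E \<in> \<C>" using E F by blast
    have "touch F (a, b) E \<noteq> touch F (a, b) G"
      using touch_p[of E] touch_p[of G] E E' G p' q_ge_2 by simp
    moreover have "(q\<^sup>2 - 1) * (touch F (x, d) E - touch F (x, d) G)
        = (q\<^sup>2 - 1) * (touch F (a, b) E - touch F (a, b) G)"
      unfolding touch_diff[OF E' E(2) G(1,3)] touch_diff[OF E' E(3) G(1,4)] ..
    then have "touch F (x, d) E - touch F (x, d) G = touch F (a, b) E - touch F (a, b) G"
      using sq_minus_1_pos by (subst (asm) mult_left_cancel) auto
    ultimately have "touch F (x, d) E \<noteq> touch F (x, d) G" by simp
    note touch_dichotomy[OF E' E(3) G(1,4) this]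
    then have "deg F (x, d) = q * codeg F (x, d) (a, b)"
      using deg_eq_mult_codeg[OF F x(1) d(1) ab] x d by blast
    then show ?thesis using mult[OF x] codeg_commute by simp
  qed
  \<comment> \<open>The \<open>q\<close> equal degrees on column \<open>d\<close> sum to at most
    \<open>card F\<close>, so the common degree is at most \<open>q - 1\<close>, although it is a
    positive multiple of \<open>q\<close>.\<close>
  have "q * deg F (a, b) = (\<Sum>x\<in>\<Omega> - {a}. deg F (a, b))"
    using card_remove_\<Omega>[OF ab(1)] by (simp del: card_Diff_singleton card_Diff_insert)
  also have "\<dots> = (\<Sum>x\<in>\<Omega> - {a}. deg F (x, d))"
    by (intro sum.cong refl deg_col[symmetric]) auto
  also have "\<dots> \<le> (\<Sum>x\<in>\<Omega>. deg F (x, d))"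
    using finite_\<Omega> deg_nonneg by (intro sum_mono2) auto
  also have "\<dots> = q * (q - 1)" using sum_deg_col[OF F d(1)] card_F by simp
  finally have "deg F (a, b) \<le> q - 1" using q_ge_2 by simp
  moreover have "q dvd deg F (a, b)" using mult[OF c] by simp
  then have "q \<le> deg F (a, b)" using deg(1) by (intro zdvd_imp_le)
  ultimately show False by simp
qed

text \<open>In \<open>sum_touch\<close> all \<open>q * (q - 1)\<close> circles through
  \<open>p\<close> now contribute the same touching number.\<close>

lemma deg_eq_mult_touch:
  assumes C: "C \<in> \<C>" and p: "p \<in> C"
  shows "deg F p = (q - 1) * touch F p C"
proof -
  have "p \<in> \<Omega> \<times> \<Omega>" using circle_subset C p by blast
  then have "q * ((q - 1) * touch F p C) = deg \<C> p * touch F p C"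
    using deg_circles by (cases p) simp
  also have "\<dots> = (\<Sum>D\<in>\<C>. of_bool (p \<in> D) * touch F p D)"
    unfolding deg_def sum_distrib_right
    by (intro sum.cong refl) (use touch_const[OF C p] in auto)
  also have "\<dots> = q * deg F p" by (rule sum_touch[OF F])
  finally show ?thesis using q_ge_2 by simp
qed

lemma extremal_deg: "\<exists>p\<in>\<Omega> \<times> \<Omega>. deg F p = q * (q - 1)"
proof -
  have ex: "\<exists>C. C \<in> \<C> \<and> (a, b) \<in> C" if "a \<in> \<Omega>" "b \<in> \<Omega>" for a b
  proof -
    have "deg \<C> (a, b) \<noteq> 0" using deg_circles[OF that] q_ge_2 by simp
    then have "card {C \<in> \<C>. (a, b) \<in> C} \<noteq> 0"
      unfolding deg_eq_card[OF finite_circles] by (rule contrapos_nn) simp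
    then have "{C \<in> \<C>. (a, b) \<in> C} \<noteq> {}" by (metis card.empty)
    then show ?thesis by simp
  qed
  \<comment> \<open>By \<open>touch_const\<close> the choice of the circle is immaterial.\<close>
  define k where "k a b = touch F (a, b) (SOME C. C \<in> \<C> \<and> (a, b) \<in> C)" for a b
  have deg: "deg F (a, b) = (q - 1) * k a b" if "a \<in> \<Omega>" "b \<in> \<Omega>" for a b
    unfolding k_def using someI_ex[OF ex[OF that]] by (intro deg_eq_mult_touch) auto
  have "\<exists>a\<in>\<Omega>. \<exists>b\<in>\<Omega>. k a b = q"
  proof (rule matrix_extremal_entry[OF finite_\<Omega> card_\<Omega> q_ge_2])
    show "0 \<le> k a b" for a b unfolding k_def by (rule touch_nonneg)
    show "(\<Sum>b\<in>\<Omega>. k a b) = q" if a: "a \<in> \<Omega>" for a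
    proof -
      have "(q - 1) * (\<Sum>b\<in>\<Omega>. k a b) = (\<Sum>b\<in>\<Omega>. deg F (a, b))"
        using deg[OF a] by (simp add: sum_distrib_left)
      also have "\<dots> = (q - 1) * q" using sum_deg_row[OF F a] card_F by simp
      finally show ?thesis using q_ge_2 by simp
    qed
    show "(\<Sum>a\<in>\<Omega>. k a b) = q" if b: "b \<in> \<Omega>" for b
    proof -
      have "(q - 1) * (\<Sum>a\<in>\<Omega>. k a b) = (\<Sum>a\<in>\<Omega>. deg F (a, b))"
        using deg[OF _ b] by (simp add: sum_distrib_left)
      also have "\<dots> = (q - 1) * q" using sum_deg_col[OF F b] card_F by simp
      finally show ?thesis using q_ge_2 by simp
    qed
    show "\<exists>m\<le>q. (q + 1) * m = q * (k a b + k c d) + k a d + k c b"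
      if abcd: "a \<in> \<Omega>" "b \<in> \<Omega>" "c \<in> \<Omega>" "d \<in> \<Omega>" "a \<noteq> c" "b \<noteq> d" for a b c d
    proof (intro exI conjI)
      \<comment> \<open>The witness \<open>m\<close> is \<open>codeg F (a, b) (c, d) + 1\<close>,
        bounded by \<open>q\<close> since only \<open>q - 1\<close> circles pass through the two
        points. Its equation is the relation for \<open>codeg F\<close> divided by
        \<open>q - 1\<close>.\<close>
      show "codeg F (a, b) (c, d) + 1 \<le> q"
        using codeg_mono[OF F] codeg_circles[OF abcd] by (metis le_diff_eq)
      have "(q - 1) * ((q + 1) * (codeg F (a, b) (c, d) + 1))
          = (q\<^sup>2 - 1) * (codeg F (a, b) (c, d) + 1)"
        by (simp add: power2_eq_square algebra_simps)
      also have "\<dots> = (q - 1) * (q * (k a b + k c d) + k a d + k c b)"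
        unfolding codeg_eq[OF abcd] deg[OF abcd(1,2)] deg[OF abcd(3,4)] deg[OF abcd(1,4)]
          deg[OF abcd(3,2)] by (simp add: algebra_simps)
      finally show "(q + 1) * (codeg F (a, b) (c, d) + 1) = q * (k a b + k c d) + k a d + k c b"
        using q_ge_2 by (subst (asm) mult_left_cancel) auto
    qed
  qed
  then show ?thesis using deg by (auto simp: mult.commute)
qed

end

text \<open>In case of equality some point has degree \<open>q * (q - 1) = card F\<close>, so all
  members pass through it; since exactly that many circles pass through any point, none is
  missing.\<close>

theorem intersecting_family_bound:
  assumes F: "F \<subseteq> \<C>" and int: "\<And>C D. C \<in> F \<Longrightarrow> D \<in> F \<Longrightarrow> C \<inter> D \<noteq> {}"
  shows "int (card F) \<le> q * (q - 1) \<and>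
    (int (card F) = q * (q - 1) \<longleftrightarrow> (\<exists>p\<in>\<Omega> \<times> \<Omega>. F = {C \<in> \<C>. p \<in> C}))"
proof (intro conjI iffI)
  have fF: "finite F" using F finite_circles finite_subset by blast
  show "int (card F) \<le> q * (q - 1)" using intersecting_card_le[OF F int] .
  show "\<exists>p\<in>\<Omega> \<times> \<Omega>. F = {C \<in> \<C>. p \<in> C}" if card: "int (card F) = q * (q - 1)"
  proof -
    obtain p where p: "p \<in> \<Omega> \<times> \<Omega>" "deg F p = q * (q - 1)"
      using extremal_deg[OF F card codeg_extremal[OF F int card]] by blast
    have "card {C \<in> F. p \<in> C} = card F" using p card by (simp add: deg_eq_card[OF fF])
    then have "{C \<in> F. p \<in> C} = F" using fF by (intro card_subset_eq) auto
    moreover have "card F = card {C \<in> \<C>. p \<in> C}"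
    proof -
      have "int (card {C \<in> \<C>. p \<in> C}) = q * (q - 1)"
        using p deg_circles by (cases p) (simp add: deg_eq_card[OF finite_circles])
      then show ?thesis using card by linarith
    qed
    ultimately have "F = {C \<in> \<C>. p \<in> C}"
      using F finite_circles by (intro card_subset_eq) auto
    then show ?thesis using p by blast
  qed
  show "int (card F) = q * (q - 1)" if "\<exists>p\<in>\<Omega> \<times> \<Omega>. F = {C \<in> \<C>. p \<in> C}"
    using that deg_circles by (auto simp: deg_eq_card[OF finite_circles])
qed

end

section \<open>The planes CM(2,q,phi)\<close>

definition is_square :: "'a::comm_monoid_mult \<Rightarrow> bool" where
  "is_square x \<longleftrightarrow> (\<exists>c. x = c * c)"

lemma is_square_mult: "is_square x \<Longrightarrow> is_square y \<Longrightarrow> is_square (x * y)"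
  unfolding is_square_def by (metis mult.assoc mult.left_commute)

lemma is_square_self: "is_square (c * c)"
  unfolding is_square_def by blast

lemma is_square_inverse: "is_square x \<Longrightarrow> is_square (inverse x)" for x :: "'a::field"
  unfolding is_square_def by (metis inverse_mult_distrib)

text \<open>Squaring is at most two-to-one, so the nonzero squares \<open>S\<close> are at least
  half of the nonzero elements. The coset of \<open>S\<close> by the nonsquare \<open>x\<close> is
  disjoint from \<open>S\<close> and equally large, so the two fill \<open>U\<close> and
  \<open>y\<close> lies in that coset.\<close>

lemma nonsquare_mult_nonsquare:
  fixes x y :: "'a::{field,finite}"
  assumes x: "\<not> is_square x" and y: "\<not> is_square y"
  shows "is_square (x * y)"
proof -
  define U S where "U = UNIV - {0::'a}" and "S = (\<lambda>c. c * c) ` U"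
  have [simp]: "finite U" "finite S" by auto
  have x0: "x \<noteq> 0" and y0: "y \<noteq> 0" using x y unfolding is_square_def by (metis mult_zero_left)+
  have fiber: "card {c \<in> U. c * c = s} \<le> 2" if s: "s \<in> S" for s
  proof -
    obtain b where "s = b * b" using s unfolding S_def by blast
    then have "{c \<in> U. c * c = s} \<subseteq> {b, - b}"
      by (auto simp: square_eq_iff)
    then have "card {c \<in> U. c * c = s} \<le> card {b, - b}" by (intro card_mono) auto
    also have "\<dots> \<le> 2" by (simp add: card_insert_if)
    finally show ?thesis .
  qed
  have "U = (\<Union>s\<in>S. {c \<in> U. c * c = s})" by (auto simp: S_def)
  then have "card U \<le> (\<Sum>s\<in>S. card {c \<in> U. c * c = s})"
    using card_UN_le[OF \<open>finite S\<close>, of "\<lambda>s. {c \<in> U. c * c = s}"] by simp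
  also have "\<dots> \<le> (\<Sum>s\<in>S. 2)" using fiber by (intro sum_mono)
  finally have card: "card U \<le> 2 * card S" by simp
  have disj: "S \<inter> (*) x ` S = {}"
  proof (rule ccontr)
    assume "\<not> ?thesis"
    then obtain a b where ab: "a \<noteq> 0" "b \<noteq> 0" "a * a = x * (b * b)" by (auto simp: S_def U_def)
    then have "x = (a / b) * (a / b)" by (simp add: field_simps)
    then show False using x is_square_self by metis
  qed
  have "card (S \<union> (*) x ` S) = card S + card ((*) x ` S)"
    using disj by (intro card_Un_disjoint) auto
  also have "card ((*) x ` S) = card S"
    using x0 by (intro card_image) (auto simp: inj_on_def)
  finally have "card U \<le> card (S \<union> (*) x ` S)" using card by simp
  moreover have "S \<union> (*) x ` S \<subseteq> U" using x0 by (auto simp: S_def U_def)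
  ultimately have "S \<union> (*) x ` S = U" by (intro card_seteq) auto
  moreover have "y \<notin> S" using y is_square_self by (auto simp: S_def)
  ultimately obtain b where "y = x * (b * b)" using y0 by (auto simp: U_def S_def)
  then have "x * y = (x * b) * (x * b)" by (simp add: mult_ac)
  then show ?thesis using is_square_self by metis
qed

text \<open>The determinant of the matrix with columns \<open>v\<close> and \<open>w\<close>; its
  vanishing turns equality of projective points into an equation.\<close>

definition cross2 :: "'a::comm_ring_1 ^ 2 \<Rightarrow> 'a ^ 2 \<Rightarrow> 'a" where
  "cross2 v w = v $ 1 * w $ 2 - v $ 2 * w $ 1"

definition line :: "'a::field ^ 2 \<Rightarrow> 'a proj_point" where
  "line v = vec.span {v}"

lemma line_eq_range: "line v = range (\<lambda>k. k *s v)"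
  by (simp add: line_def vec.span_singleton)

lemma vec2_eq_iff: "v = w \<longleftrightarrow> v $ 1 = w $ 1 \<and> v $ 2 = w $ 2" for v w :: "'a ^ 2"
  by (simp add: vec_eq_iff forall_2)

lemma mat2_mult_vec: "(A *v v) $ i = A $ i $ 1 * v $ 1 + A $ i $ 2 * v $ 2"
  for A :: "'a::comm_ring_1 ^ 2 ^ 2"
  by (simp add: matrix_vector_mult_def sum_2)

lemma cross2_smult: "cross2 (k *s v) w = k * cross2 v w" "cross2 v (k *s w) = k * cross2 v w"
  by (simp_all add: cross2_def algebra_simps)

lemma cross2_add: "cross2 (v + v') w = cross2 v w + cross2 v' w" "cross2 v (w + w') = cross2 v w + cross2 v w'"
  by (simp_all add: cross2_def algebra_simps)

lemma cross2_self [simp]: "cross2 v v = 0"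
  by (simp add: cross2_def)

lemma cross2_swap: "cross2 w v = - cross2 v w"
  by (simp add: cross2_def)

lemma cross2_zero [simp]: "cross2 0 w = 0" "cross2 v 0 = 0"
  by (simp_all add: cross2_def)

lemma cross2_matrix: "cross2 (A *v v) (A *v w) = det A * cross2 v w"
  by (simp add: cross2_def mat2_mult_vec det_2 algebra_simps)

lemma cross2_ex_nonzero:
  fixes v :: "'a::field ^ 2" assumes "v \<noteq> 0" shows "\<exists>w. cross2 v w \<noteq> 0"
proof (cases "v $ 1 = 0")
  case True
  then have "v $ 2 \<noteq> 0" using assms by (simp add: vec2_eq_iff)
  then show ?thesis by (intro exI[of _ "axis 1 1"]) (simp add: cross2_def axis_def)
next
  case False
  then show ?thesis by (intro exI[of _ "axis 2 1"]) (simp add: cross2_def axis_def)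
qed

lemma mem_line_iff:
  fixes v w :: "'a::field ^ 2" assumes "v \<noteq> 0"
  shows "w \<in> line v \<longleftrightarrow> cross2 v w = 0"
proof
  assume "w \<in> line v"
  then show "cross2 v w = 0" by (auto simp: line_eq_range cross2_smult)
next
  assume *: "cross2 v w = 0"
  show "w \<in> line v"
  proof (cases "v $ 1 = 0")
    case True
    then have "v $ 2 \<noteq> 0" using assms by (simp add: vec2_eq_iff)
    then have "w = (w $ 2 / v $ 2) *s v" using * True by (simp add: vec2_eq_iff cross2_def)
    then show ?thesis by (auto simp: line_eq_range)
  next
    case False
    then have "w = (w $ 1 / v $ 1) *s v" using * by (simp add: vec2_eq_iff cross2_def field_simps)
    then show ?thesis by (auto simp: line_eq_range)
  qed
qed

lemma line_smult:
  fixes v :: "'a::field ^ 2" assumes "k \<noteq> 0" shows "line (k *s v) = line v"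
proof -
  have 1: "c *s v = (c / k) *s (k *s v)" for c using assms by (simp add: vec_eq_iff)
  have 2: "c *s (k *s v) = (c * k) *s v" for c by (simp add: vec_eq_iff)
  show ?thesis unfolding line_eq_range
  proof (intro equalityI image_subsetI)
    show "c *s (k *s v) \<in> range (\<lambda>c. c *s v)" for c unfolding 2 by (rule rangeI)
    show "c *s v \<in> range (\<lambda>c. c *s (k *s v))" for c by (subst 1) (rule rangeI)
  qed
qed

lemma line_eq_iff:
  fixes v w :: "'a::field ^ 2" assumes v: "v \<noteq> 0" and w: "w \<noteq> 0"
  shows "line v = line w \<longleftrightarrow> cross2 v w = 0"
proof
  assume "line v = line w"
  moreover have "w \<in> line w" using mem_line_iff[OF w] by simp
  ultimately show "cross2 v w = 0" using mem_line_iff[OF v] by blast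
next
  assume "cross2 v w = 0"
  then obtain k where k: "w = k *s v"
    using mem_line_iff[OF v] by (auto simp: line_eq_range)
  then have "k \<noteq> 0" using w by auto
  then show "line v = line w" using line_smult[of k v] k by simp
qed

section \<open>Points of PG(1,q) and cosets in PGL(2,q)\<close>

lemma PG1_eq: "(PG1 :: 'a::field proj_point set) = {line v |v. v \<noteq> 0}"
proof (intro equalityI subsetI)
  fix L :: "'a proj_point" assume "L \<in> PG1"
  then have L: "vec.subspace L" "vec.dim L = 1" by (auto simp: PG1_def)
  obtain B where B: "B \<subseteq> L" "vec.independent B" "L \<subseteq> vec.span B" "card B = vec.dim L"
    using vec.basis_exists by blast
  then obtain v where v: "B = {v}" using L by (metis card_1_singletonE)
  then have "L = vec.span {v}" using B L vec.span_minimal by blast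
  moreover have "v \<noteq> 0" using B v vec.dependent_zero by blast
  ultimately show "L \<in> {line v |v. v \<noteq> 0}" by (auto simp: line_def)
next
  fix L :: "'a proj_point" assume "L \<in> {line v |v. v \<noteq> 0}"
  then show "L \<in> PG1" by (auto simp: PG1_def line_def)
qed

lemma card_PG1: "card (PG1 :: 'a::{field,finite} proj_point set) = CARD('a) + 1"
proof -
  \<comment> \<open>The vectors \<open>e t\<close> represent the affine points, and \<open>f\<close>
    the point at infinity.\<close>
  define e :: "'a \<Rightarrow> 'a ^ 2" where "e t = vector [1, t]" for t
  define f :: "'a ^ 2" where "f = vector [0, 1]"
  have e: "e t $ 1 = 1" "e t $ 2 = t" for t by (simp_all add: e_def)
  have f: "f $ 1 = 0" "f $ 2 = 1" by (simp_all add: f_def)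
  have nz: "e t \<noteq> 0" "f \<noteq> 0" for t by (simp_all add: vec2_eq_iff e f)
  have PG1: "(PG1 :: 'a proj_point set) = insert (line f) (range (\<lambda>t. line (e t)))"
  proof (intro equalityI subsetI)
    fix L :: "'a proj_point" assume "L \<in> PG1"
    then obtain v where v: "L = line v" "v \<noteq> 0" by (auto simp: PG1_eq)
    show "L \<in> insert (line f) (range (\<lambda>t. line (e t)))"
    proof (cases "v $ 1 = 0")
      case True
      then have "line v = line f" using v nz by (simp add: line_eq_iff cross2_def f)
      then show ?thesis using v by simp
    next
      case False
      then have "line v = line (e (v $ 2 / v $ 1))" using v nz by (simp add: line_eq_iff cross2_def e)
      then show ?thesis using v by simp
    qed
  next
    fix L :: "'a proj_point" assume "L \<in> insert (line f) (range (\<lambda>t. line (e t)))"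
    then show "L \<in> PG1" using nz by (auto simp: PG1_eq)
  qed
  have "line f \<notin> range (\<lambda>t. line (e t))"
    using nz by (auto simp: line_eq_iff cross2_def e f)
  moreover have "inj (\<lambda>t. line (e t))"
    using nz by (auto simp: inj_on_def line_eq_iff cross2_def e)
  ultimately show ?thesis unfolding PG1 by (simp add: card_image)
qed

lemma matrix_line: "(\<lambda>v. A *v v) ` line v = line (A *v v)" for A :: "'a::field ^ 2 ^ 2"
  unfolding line_eq_range image_image by (simp add: vec.scale)

lemma coset_scalars2: "scalars2 #>\<^bsub>GL2\<^esub> A = {mat c ** A |c. c \<noteq> 0}"
  by (auto simp: r_coset_def scalars2_def GL2_def)

lemma carrier_PGL2: "carrier PGL2 = {scalars2 #>\<^bsub>GL2\<^esub> A |A. det A \<noteq> 0}"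
  by (auto simp: PGL2_def FactGroup_def RCOSETS_def GL2_def invertible_det_nz)

lemma det_mat_mult: "det (mat c ** A) = c * c * det A" for A :: "'a::field ^ 2 ^ 2"
  by (simp add: det_mul) (simp add: det_2 mat_def)

lemma coset_smult:
  fixes A :: "'a::field ^ 2 ^ 2" assumes "k \<noteq> 0"
  shows "scalars2 #>\<^bsub>GL2\<^esub> (mat k ** A) = scalars2 #>\<^bsub>GL2\<^esub> A"
proof -
  have m: "mat c ** (mat k ** A) = mat (c * k) ** A" for c
    by (simp add: matrix_mul_assoc) (simp add: vec_eq_iff matrix_matrix_mult_def mat_def sum_2 forall_2)
  have "mat c ** A = mat (c / k) ** (mat k ** A)" for c using assms by (simp add: m)
  then show ?thesis unfolding coset_scalars2 m using assms
    by (smt (verit) Collect_cong divide_eq_0_iff m mult_eq_0_iff nonzero_eq_divide_eq)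
qed

text \<open>Scaling a 2 x 2 matrix by \<open>c\<close> multiplies its determinant by
  \<open>c * c\<close>, so a representative of determinant 1 exists exactly when the determinant is
  a square.\<close>

lemma coset_in_PSL2_iff:
  fixes A :: "'a::field ^ 2 ^ 2" assumes A: "det A \<noteq> 0"
  shows "scalars2 #>\<^bsub>GL2\<^esub> A \<in> PSL2 \<longleftrightarrow> is_square (det A)"
proof
  assume "scalars2 #>\<^bsub>GL2\<^esub> A \<in> PSL2"
  then obtain B :: "'a ^ 2 ^ 2" where B: "det B = 1" "scalars2 #>\<^bsub>GL2\<^esub> A = scalars2 #>\<^bsub>GL2\<^esub> B"
    by (auto simp: PSL2_def SL2_def)
  have "mat 1 ** A \<in> scalars2 #>\<^bsub>GL2\<^esub> A" 
    unfolding coset_scalars2 by (intro CollectI exI[of _ 1]) simp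
  then have "A \<in> scalars2 #>\<^bsub>GL2\<^esub> B" unfolding B(2) matrix_mul_lid .
  then obtain c where "A = mat c ** B" unfolding coset_scalars2 by blast
  then have "det A = c * c" using B(1) det_mat_mult[of c B] by simp
  then show "is_square (det A)" using is_square_self by metis
next
  assume "is_square (det A)"
  then obtain c where c: "det A = c * c" unfolding is_square_def by blast
  then have "c \<noteq> 0" using A by auto
  then have "det (mat (inverse c) ** A) = 1"
    unfolding det_mat_mult c by (simp add: field_simps)
  moreover have "scalars2 #>\<^bsub>GL2\<^esub> A = scalars2 #>\<^bsub>GL2\<^esub> (mat (inverse c) ** A)"
    using coset_smult[of "inverse c" A] \<open>c \<noteq> 0\<close> by simp
  ultimately show "scalars2 #>\<^bsub>GL2\<^esub> A \<in> PSL2" by (auto simp: PSL2_def SL2_def)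
qed

section \<open>Matrices and projective frames\<close>

definition map_vec2 :: "('a \<Rightarrow> 'a) \<Rightarrow> 'a ^ 2 \<Rightarrow> 'a ^ 2" where
  "map_vec2 \<phi> v = (\<chi> i. \<phi> (v $ i))"

lemma map_vec2_nth [simp]: "map_vec2 \<phi> v $ i = \<phi> (v $ i)"
  by (simp add: map_vec2_def)

lemma matrix_exists:
  fixes v1 v2 w1 w2 :: "'a::field ^ 2" assumes "cross2 v1 v2 \<noteq> 0"
  shows "\<exists>A. A *v v1 = w1 \<and> A *v v2 = w2"
proof -
  let ?d = "cross2 v1 v2"
  \<comment> \<open>Cramer's rule, applied to each row of the matrix.\<close>
  define A :: "'a ^ 2 ^ 2" where "A = (\<chi> i j. if j = 1
    then (v2 $ 2 * w1 $ i - v1 $ 2 * w2 $ i) / ?d else (v1 $ 1 * w2 $ i - v2 $ 1 * w1 $ i) / ?d)"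
  have "(A *v v1) $ i = (?d * w1 $ i) / ?d" "(A *v v2) $ i = (?d * w2 $ i) / ?d" for i
    by (simp_all add: mat2_mult_vec A_def cross2_def algebra_simps flip: add_divide_distrib diff_divide_distrib)
  then show ?thesis using assms by (auto simp: vec_eq_iff)
qed

lemma matrix_eq_on_basis:
  fixes A B :: "'a::field ^ 2 ^ 2"
  assumes d: "cross2 v1 v2 \<noteq> 0" and "A *v v1 = B *v v1" "A *v v2 = B *v v2"
  shows "A = B"
proof -
  have "A $ i $ 1 = B $ i $ 1 \<and> A $ i $ 2 = B $ i $ 2" for i
  proof -
    define x y where "x = A $ i $ 1 - B $ i $ 1" and "y = A $ i $ 2 - B $ i $ 2"
    have 1: "x * v1 $ 1 + y * v1 $ 2 = 0" and 2: "x * v2 $ 1 + y * v2 $ 2 = 0"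
      using arg_cong[OF assms(2), of "\<lambda>u. u $ i"] arg_cong[OF assms(3), of "\<lambda>u. u $ i"]
      by (simp_all add: mat2_mult_vec x_def y_def algebra_simps)
    have "x * cross2 v1 v2 = v2 $ 2 * (x * v1 $ 1 + y * v1 $ 2) - v1 $ 2 * (x * v2 $ 1 + y * v2 $ 2)"
      "y * cross2 v1 v2 = v1 $ 1 * (x * v2 $ 1 + y * v2 $ 2) - v2 $ 1 * (x * v1 $ 1 + y * v1 $ 2)"
      by (simp_all add: cross2_def algebra_simps)
    then have "x = 0" "y = 0" using d unfolding 1 2 by simp_all
    then show ?thesis by (simp add: x_def y_def)
  qed
  then show ?thesis by (simp add: vec_eq_iff forall_2)
qed

lemma PG1_frame:
  fixes x1 x2 x3 :: "'a::field proj_point"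
  assumes "{x1, x2, x3} \<subseteq> PG1" "distinct [x1, x2, x3]"
  shows "\<exists>v1 v2. cross2 v1 v2 \<noteq> 0 \<and> x1 = line v1 \<and> x2 = line v2 \<and> x3 = line (v1 + v2)"
proof -
  obtain u1 u2 u3 where u: "x1 = line u1" "u1 \<noteq> 0" "x2 = line u2" "u2 \<noteq> 0" "x3 = line u3" "u3 \<noteq> 0"
    using assms by (auto simp: PG1_eq)
  have nz: "cross2 u1 u2 \<noteq> 0" "cross2 u1 u3 \<noteq> 0" "cross2 u3 u2 \<noteq> 0"
    using assms u line_eq_iff[of u1 u2] line_eq_iff[of u1 u3] line_eq_iff[of u3 u2] by auto
  \<comment> \<open>The scalars come from the linear relation between three vectors of the plane;
    they are nonzero because the points are distinct.\<close>
  let ?v1 = "cross2 u3 u2 *s u1" and ?v2 = "cross2 u1 u3 *s u2"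
  have "?v1 + ?v2 = cross2 u1 u2 *s u3"
    by (simp add: vec2_eq_iff cross2_def algebra_simps)
  then show ?thesis
    using nz u by (intro exI[of _ ?v1] exI[of _ ?v2]) (simp add: line_smult cross2_smult)
qed

text \<open>The first two conditions give a scalar for each basis vector; the condition on the sums
  forces the two scalars to agree.\<close>

lemma frame_image:
  fixes A :: "'a::field ^ 2 ^ 2"
  assumes w: "cross2 w1 w2 \<noteq> 0"
    and "cross2 w1 (A *v v1) = 0" "cross2 w2 (A *v v2) = 0" "cross2 (w1 + w2) (A *v (v1 + v2)) = 0"
  shows "\<exists>c. A *v v1 = c *s w1 \<and> A *v v2 = c *s w2"
proof -
  have "w1 \<noteq> 0" "w2 \<noteq> 0" using w by auto
  then obtain a b where ab: "A *v v1 = a *s w1" "A *v v2 = b *s w2"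
    using assms mem_line_iff[of w1 "A *v v1"] mem_line_iff[of w2 "A *v v2"] by (auto simp: line_eq_range)
  have "(b - a) * cross2 w1 w2 = 0"
    using assms(4) unfolding vec.add ab
    by (simp add: cross2_add cross2_smult cross2_swap[of w2 w1] algebra_simps)
  then have "a = b" using w by simp
  then show ?thesis using ab by blast
qed

lemma nonzero_of_cross2:
  assumes "cross2 v1 v2 \<noteq> 0"
  shows "v1 \<noteq> 0" "v2 \<noteq> 0" "v1 + v2 \<noteq> 0"
proof -
  have "cross2 v1 (v1 + v2) \<noteq> 0" using assms by (simp add: cross2_add)
  then show "v1 \<noteq> 0" "v2 \<noteq> 0" "v1 + v2 \<noteq> 0" using assms by auto
qed

section \<open>Circles of CM(2,q,\<phi>) in coordinates\<close>

locale twisted_circles =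
  fixes \<phi> :: "'a::{field,finite} \<Rightarrow> 'a"
  assumes aut: "field_automorphism \<phi>"
begin

lemma \<phi>_simps: "\<phi> (x + y) = \<phi> x + \<phi> y" "\<phi> (x * y) = \<phi> x * \<phi> y" "\<phi> 1 = 1" "bij \<phi>"
  using aut by (auto simp: field_automorphism_def)

lemma \<phi>_0 [simp]: "\<phi> 0 = 0"
  using \<phi>_simps(1)[of 0 0] by (metis add.right_neutral add_left_cancel)

lemma \<phi>_diff: "\<phi> (x - y) = \<phi> x - \<phi> y"
  using \<phi>_simps(1)[of "x - y" y] by simp

lemma \<phi>_eq_0_iff [simp]: "\<phi> x = 0 \<longleftrightarrow> x = 0"
  using \<phi>_simps(4) \<phi>_0 by (metis bij_pointE)

lemma cross2_map_vec2: "cross2 (map_vec2 \<phi> v) (map_vec2 \<phi> w) = \<phi> (cross2 v w)"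
  by (simp add: cross2_def \<phi>_simps \<phi>_diff)

lemma coord_act_line: "coord_act \<phi> (line v) = line (map_vec2 \<phi> v)"
proof -
  have "coord_act \<phi> (line v) = (\<lambda>k. \<phi> k *s map_vec2 \<phi> v) ` UNIV"
    unfolding coord_act_def line_eq_range image_image
    by (intro image_cong refl) (simp add: vec_eq_iff \<phi>_simps)
  also have "\<dots> = (\<lambda>k. k *s map_vec2 \<phi> v) ` (\<phi> ` UNIV)" by (simp add: image_image)
  also have "\<phi> ` UNIV = UNIV" using \<phi>_simps(4) by (simp add: bij_is_surj)
  finally show ?thesis by (simp add: line_eq_range)
qed

text \<open>An automorphism preserves squares and nonsquares, so \<open>d\<close> and
  \<open>\<phi> d\<close> are both squares or both nonsquares.\<close>

lemma is_square_mult_\<phi>: "is_square (d * \<phi> d)"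
proof (cases "is_square d")
  case True
  then have "is_square (\<phi> d)" unfolding is_square_def using \<phi>_simps(2) by metis
  then show ?thesis using True is_square_mult by blast
next
  case False
  have "\<not> is_square (\<phi> d)"
  proof
    assume "is_square (\<phi> d)"
    then obtain c where c: "\<phi> d = c * c" unfolding is_square_def by blast
    obtain b where "c = \<phi> b" using \<phi>_simps(4) by (metis bij_pointE)
    then have "\<phi> d = \<phi> (b * b)" using c \<phi>_simps(2) by simp
    then have "d = b * b" using \<phi>_simps(4) by (simp add: bij_is_inj inj_eq)
    then show False using False is_square_self by metis
  qed
  then show ?thesis using False nonsquare_mult_nonsquare by blast
qed

text \<open>The determinants of the linear and of the twisted solution for three given points are in the same
  square class, so exactly one of the two defines a circle through them.\<close>

lemma is_square_transfer:
  assumes nz: "d \<noteq> 0" "e \<noteq> 0" "a \<noteq> 0" "b \<noteq> 0"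
    and x: "x * d = a * a * e" and y: "y * \<phi> d = b * b * e"
  shows "is_square x \<longleftrightarrow> is_square y"
proof
  have \<phi>d: "\<phi> d \<noteq> 0" using nz by simp
  have y': "y = b * b * e / \<phi> d" using y \<phi>d by (simp add: field_simps)
  have x': "x = a * a * e / d" using x nz by (simp add: field_simps)
  \<comment> \<open>The quotient of \<open>y\<close> by \<open>x\<close> is
    \<open>d * \<phi> d\<close> times a square, hence a square.\<close>
  have "y = x * (d * \<phi> d) * ((b / (a * \<phi> d)) * (b / (a * \<phi> d)))"
    unfolding x' y' using nz \<phi>d by (simp add: field_simps)
  then show "is_square y" if "is_square x"
    using that is_square_mult is_square_mult_\<phi> is_square_self by metis
  have "x = y * (d * \<phi> d) * ((a / (b * d)) * (a / (b * d)))"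
    unfolding x' y' using nz \<phi>d by (simp add: field_simps)
  then show "is_square x" if "is_square y"
    using that is_square_mult is_square_mult_\<phi> is_square_self by metis
qed

text \<open>For invertible \<open>A\<close> the condition says that the coset of \<open>A\<close>
  lies in \<open>PSL2\<close>, so \<open>A *v twist A v\<close> represents the image of
  \<open>line v\<close> under the map of that coset.\<close>

definition twist :: "'a ^ 2 ^ 2 \<Rightarrow> 'a ^ 2 \<Rightarrow> 'a ^ 2" where
  "twist A v = (if is_square (det A) then v else map_vec2 \<phi> v)"

definition circle :: "'a ^ 2 ^ 2 \<Rightarrow> ('a proj_point \<times> 'a proj_point) set" where
  "circle A = {(line v, line (A *v twist A v)) |v. v \<noteq> 0}"

lemma CM_circles_eq: "CM_circles \<phi> = {circle A |A. det A \<noteq> 0}"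
proof -
  have "{(x, CM_map \<phi> (scalars2 #>\<^bsub>GL2\<^esub> A) x) |x. x \<in> PG1} = circle A" if A: "det A \<noteq> 0" for A
  proof -
    have "CM_map \<phi> (scalars2 #>\<^bsub>GL2\<^esub> A) (line v) = line (A *v twist A v)" if v: "v \<noteq> 0" for v
    proof -
      have PG: "line v \<in> PG1" using v by (auto simp: PG1_eq)
      have "map_vec2 \<phi> v \<noteq> 0" using v by (auto simp: vec2_eq_iff)
      then have PG': "line (map_vec2 \<phi> v) \<in> PG1" by (auto simp: PG1_eq)
      show ?thesis
        using pgl_act_coset[OF PG, of A] pgl_act_coset[OF PG', of A]
        by (simp add: CM_map_def coset_in_PSL2_iff[OF A] twist_def matrix_line coord_act_line)
    qed
    then show ?thesis unfolding circle_def PG1_eq by auto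
  qed
  then show ?thesis unfolding CM_circles_def carrier_PGL2 by auto
qed

lemma twist_nonzero: "v \<noteq> 0 \<Longrightarrow> twist A v \<noteq> 0"
  by (auto simp: twist_def vec2_eq_iff)

lemma matrix_vec_nonzero: "det A \<noteq> 0 \<Longrightarrow> v \<noteq> 0 \<Longrightarrow> A *v v \<noteq> 0" for A :: "'a ^ 2 ^ 2"
proof
  assume "det A \<noteq> 0" "v \<noteq> 0" "A *v v = 0"
  then obtain w where "cross2 v w \<noteq> 0" using cross2_ex_nonzero by blast
  then show False using cross2_matrix[of A v w] \<open>A *v v = 0\<close> \<open>det A \<noteq> 0\<close> by simp
qed

lemma cross2_twist:
  "cross2 (twist A v) (twist A w) = (if is_square (det A) then cross2 v w else \<phi> (cross2 v w))"
  by (simp add: twist_def cross2_map_vec2)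

lemma cross2_twist_eq_0_iff: "cross2 (twist A v) (twist A w) = 0 \<longleftrightarrow> cross2 v w = 0"
  by (simp add: cross2_twist)

lemma line_twist_eq_iff:
  assumes A: "det A \<noteq> 0" and "v \<noteq> 0" "w \<noteq> 0"
  shows "line (A *v twist A v) = line (A *v twist A w) \<longleftrightarrow> line v = line w"
  using assms
  by (simp add: line_eq_iff matrix_vec_nonzero twist_nonzero cross2_matrix cross2_twist_eq_0_iff)

lemma mem_circle_iff:
  assumes A: "det A \<noteq> 0" and v: "v \<noteq> 0" and w: "w \<noteq> 0"
  shows "(line v, line w) \<in> circle A \<longleftrightarrow> cross2 w (A *v twist A v) = 0"
proof -
  have "(line v, line w) \<in> circle A \<longleftrightarrow> line w = line (A *v twist A v)"
  proof
    assume "(line v, line w) \<in> circle A"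
    then obtain u where "u \<noteq> 0" "line v = line u" "line w = line (A *v twist A u)"
      unfolding circle_def by blast
    then show "line w = line (A *v twist A v)" using line_twist_eq_iff[OF A v] by metis
  qed (use v in \<open>auto simp: circle_def\<close>)
  then show ?thesis using w matrix_vec_nonzero[OF A twist_nonzero[OF v]] by (simp add: line_eq_iff)
qed

lemma twist_surj:
  assumes "u \<noteq> 0"
  shows "\<exists>v. v \<noteq> 0 \<and> twist A v = u"
proof (cases "is_square (det A)")
  case True
  then show ?thesis using assms by (auto simp: twist_def)
next
  case False
  have "map_vec2 \<phi> (map_vec2 (inv_into UNIV \<phi>) u) = u"
    using \<phi>_simps(4) by (simp add: vec_eq_iff bij_is_surj surj_f_inv_f)
  moreover have "map_vec2 (inv_into UNIV \<phi>) u \<noteq> 0"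
    using calculation assms by (auto simp: vec2_eq_iff)
  ultimately show ?thesis using False by (auto simp: twist_def)
qed

lemma circle_smult:
  assumes k: "k \<noteq> 0" shows "circle (mat k ** A) = circle A"
proof -
  have "is_square (det (mat k ** A)) \<longleftrightarrow> is_square (det A)"
  proof
    assume "is_square (det (mat k ** A))"
    then have "is_square (inverse (k * k) * (k * k * det A))"
      unfolding det_mat_mult by (rule is_square_mult[OF is_square_inverse[OF is_square_self]])
    moreover have "inverse (k * k) * (k * k * det A) = det A" using k by (simp add: field_simps)
    ultimately show "is_square (det A)" by (simp only:)
  next
    assume "is_square (det A)"
    then show "is_square (det (mat k ** A))"
      unfolding det_mat_mult by (rule is_square_mult[OF is_square_self])
  qed
  then have "twist (mat k ** A) = twist A" by (auto simp: twist_def fun_eq_iff)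
  then show ?thesis unfolding circle_def using k by (simp add: mat_mult_vec line_smult)
qed

lemma twist_add: "twist C (v + w) = twist C v + twist C w"
  by (simp add: twist_def vec_eq_iff \<phi>_simps)

text \<open>Mapping one frame to another fixes the determinant up to a square factor, so both
  matrices have the same twist. They then agree, up to a scalar, on a basis.\<close>

lemma circle_three_points_unique:
  assumes A: "det A \<noteq> 0" and B: "det B \<noteq> 0"
    and v: "cross2 v1 v2 \<noteq> 0" and w: "cross2 w1 w2 \<noteq> 0"
    and mem: "\<And>C. C \<in> {A, B} \<Longrightarrow> (line v1, line w1) \<in> circle C \<and> (line v2, line w2) \<in> circle C
        \<and> (line (v1 + v2), line (w1 + w2)) \<in> circle C"
  shows "circle A = circle B"
proof -
  note nz = nonzero_of_cross2[OF v] nonzero_of_cross2[OF w]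
  have scal: "\<exists>c. c \<noteq> 0 \<and> C *v twist C v1 = c *s w1 \<and> C *v twist C v2 = c *s w2
      \<and> det C * cross2 (twist C v1) (twist C v2) = c * c * cross2 w1 w2"
    if C: "C \<in> {A, B}" for C
  proof -
    have detC: "det C \<noteq> 0" using C A B by auto
    have "cross2 w1 (C *v twist C v1) = 0" "cross2 w2 (C *v twist C v2) = 0"
      "cross2 (w1 + w2) (C *v (twist C v1 + twist C v2)) = 0"
      using mem[OF C] detC nz by (simp_all add: mem_circle_iff flip: twist_add)
    then obtain c where c: "C *v twist C v1 = c *s w1" "C *v twist C v2 = c *s w2"
      using frame_image[OF w, of C] by blast
    moreover have "det C * cross2 (twist C v1) (twist C v2) = c * c * cross2 w1 w2"
      unfolding cross2_matrix[symmetric] c by (simp add: cross2_smult)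
    moreover have "c \<noteq> 0"
      using c(1) matrix_vec_nonzero[OF detC twist_nonzero[OF nz(1)]] by auto
    ultimately show ?thesis by blast
  qed
  obtain a where a: "a \<noteq> 0" "A *v twist A v1 = a *s w1" "A *v twist A v2 = a *s w2"
      "det A * cross2 (twist A v1) (twist A v2) = a * a * cross2 w1 w2" using scal[of A] by auto
  obtain b where b: "b \<noteq> 0" "B *v twist B v1 = b *s w1" "B *v twist B v2 = b *s w2"
      "det B * cross2 (twist B v1) (twist B v2) = b * b * cross2 w1 w2" using scal[of B] by auto
  \<comment> \<open>Only the mixed cases matter: one matrix then acts linearly and the other through
    \<open>\<phi>\<close>, and \<open>is_square_transfer\<close> excludes them.\<close>
  have "is_square (det A) \<longleftrightarrow> is_square (det B)"
    using is_square_transfer[OF v w a(1) b(1), of "det A" "det B"]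
      is_square_transfer[OF v w b(1) a(1), of "det B" "det A"] a(4) b(4)
    unfolding cross2_twist by (cases "is_square (det A)"; cases "is_square (det B)") simp_all
  then have twist: "twist B = twist A" by (auto simp: twist_def fun_eq_iff)
  have scale: "A *v u = (mat (a / b) ** B) *v u" if "A *v u = a *s w" "B *v u = b *s w" for u w
    using that b(1) by (simp add: mat_mult_vec vector_smult_assoc)
  have "A = mat (a / b) ** B"
  proof (rule matrix_eq_on_basis)
    show "cross2 (twist A v1) (twist A v2) \<noteq> 0" using v by (simp add: cross2_twist_eq_0_iff)
  qed (rule scale[OF a(2) b(2)[unfolded twist]] scale[OF a(3) b(3)[unfolded twist]])+
  then show ?thesis using circle_smult[of "a / b" B] a b by simp
qed

text \<open>A linear solution \<open>A\<close> and a twisted solution \<open>B\<close> both exist,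
  and their determinants are both squares or both nonsquares. In the first case \<open>A\<close> is
  used with its correct twist, in the second \<open>B\<close>.\<close>

lemma circle_three_points_exists:
  assumes v: "cross2 v1 v2 \<noteq> 0" and w: "cross2 w1 w2 \<noteq> 0"
  shows "\<exists>A. det A \<noteq> 0 \<and> (line v1, line w1) \<in> circle A \<and> (line v2, line w2) \<in> circle A
        \<and> (line (v1 + v2), line (w1 + w2)) \<in> circle A"
proof -
  have suff: ?thesis if C: "C *v twist C v1 = w1" "C *v twist C v2 = w2" for C
  proof -
    have "det C * cross2 (twist C v1) (twist C v2) = cross2 w1 w2"
      unfolding cross2_matrix[symmetric] C ..
    then have "det C \<noteq> 0" using w by auto
    moreover have "C *v twist C (v1 + v2) = w1 + w2" by (simp add: twist_add vec.add C)
    ultimately show ?thesis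
      using C nonzero_of_cross2[OF v] nonzero_of_cross2[OF w]
      by (intro exI[of _ C]) (simp add: mem_circle_iff)
  qed
  obtain A where A: "A *v v1 = w1" "A *v v2 = w2" using matrix_exists[OF v] by blast
  obtain B where B: "B *v map_vec2 \<phi> v1 = w1" "B *v map_vec2 \<phi> v2 = w2"
    using matrix_exists[of "map_vec2 \<phi> v1" "map_vec2 \<phi> v2"] v by (auto simp: cross2_map_vec2)
  have "det A * cross2 v1 v2 = 1 * 1 * cross2 w1 w2" "det B * \<phi> (cross2 v1 v2) = 1 * 1 * cross2 w1 w2"
    using cross2_matrix[of A v1 v2] cross2_matrix[of B "map_vec2 \<phi> v1" "map_vec2 \<phi> v2"] A B
    by (simp_all add: cross2_map_vec2)
  then have "is_square (det A) \<longleftrightarrow> is_square (det B)"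
    by (rule is_square_transfer[OF v w one_neq_zero one_neq_zero])
  then show ?thesis using suff[of A] suff[of B] A B by (cases "is_square (det A)") (auto simp: twist_def)
qed

section \<open>The incidence axioms and the final theorem\<close>

lemma minkowski_plane: "minkowski_plane PG1 (CM_circles \<phi>) (int CARD('a))"
proof
  show "finite (PG1 :: 'a proj_point set)" by simp
  show "int (card (PG1 :: 'a proj_point set)) = int CARD('a) + 1" by (simp add: card_PG1)
  have "card {0, 1 :: 'a} \<le> CARD('a)" by (intro card_mono) auto
  then show "2 \<le> int CARD('a)" by simp
next
  fix C assume "C \<in> CM_circles \<phi>"
  then obtain A where C: "C = circle A" and A: "det A \<noteq> 0" by (auto simp: CM_circles_eq)
  have image: "A *v twist A v \<noteq> 0" if "v \<noteq> 0" for v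
    using matrix_vec_nonzero[OF A twist_nonzero[OF that]] .
  show "C \<subseteq> PG1 \<times> PG1" using image by (auto simp: C circle_def PG1_eq)
  show "\<exists>!y. (x, y) \<in> C" if x: "x \<in> PG1" for x
  proof -
    obtain v where v: "x = line v" "v \<noteq> 0" using x by (auto simp: PG1_eq)
    show ?thesis
    proof
      show "(x, line (A *v twist A v)) \<in> C" using v by (auto simp: C circle_def)
    next
      fix y assume "(x, y) \<in> C"
      then obtain u where "u \<noteq> 0" "x = line u" "y = line (A *v twist A u)"
        unfolding C circle_def by blast
      then show "y = line (A *v twist A v)" using line_twist_eq_iff[OF A] v by metis
    qed
  qed
  show "\<exists>!x. (x, y) \<in> C" if y: "y \<in> PG1" for y
  proof -
    obtain w where w: "y = line w" "w \<noteq> 0" using y by (auto simp: PG1_eq)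
    obtain u where u: "A *v u = w"
      using A by (metis invertible_det_nz invertible_def matrix_vector_mul_assoc matrix_vector_mul_lid)
    then have "u \<noteq> 0" using w by auto
    then obtain v where v: "v \<noteq> 0" "twist A v = u" using twist_surj by blast
    show ?thesis
    proof
      show "(line v, y) \<in> C" using v u w by (auto simp: C circle_def)
    next
      fix x assume "(x, y) \<in> C"
      then obtain t where "t \<noteq> 0" "x = line t" "y = line (A *v twist A t)"
        unfolding C circle_def by blast
      then show "x = line v" using line_twist_eq_iff[OF A] v u w by metis
    qed
  qed
next
  fix x1 x2 x3 y1 y2 y3 :: "'a proj_point"
  assume "{x1, x2, x3} \<subseteq> PG1" "distinct [x1, x2, x3]"
  from PG1_frame[OF this] obtain v1 v2 where v: "cross2 v1 v2 \<noteq> 0" "x1 = line v1" "x2 = line v2" "x3 = line (v1 + v2)"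
    by blast
  assume "{y1, y2, y3} \<subseteq> PG1" "distinct [y1, y2, y3]"
  from PG1_frame[OF this] obtain w1 w2 where w: "cross2 w1 w2 \<noteq> 0" "y1 = line w1" "y2 = line w2" "y3 = line (w1 + w2)"
    by blast
  let ?P = "\<lambda>C. (x1, y1) \<in> C \<and> (x2, y2) \<in> C \<and> (x3, y3) \<in> C"
  obtain A where A: "det A \<noteq> 0" "?P (circle A)"
    using circle_three_points_exists[OF v(1) w(1)] v w by blast
  show "\<exists>!C. C \<in> CM_circles \<phi> \<and> ?P C"
  proof (rule ex1I[of _ "circle A"])
    show "circle A \<in> CM_circles \<phi> \<and> ?P (circle A)" using A by (auto simp: CM_circles_eq)
  next
    fix C assume C: "C \<in> CM_circles \<phi> \<and> ?P C"
    then obtain B where B: "C = circle B" "det B \<noteq> 0" by (auto simp: CM_circles_eq)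
    show "C = circle A"
      unfolding B(1)
    proof (rule circle_three_points_unique[OF B(2) A(1) v(1) w(1)])
      fix X assume "X \<in> {B, A}"
      then have "?P (circle X)" using A C B by auto
      then show "(line v1, line w1) \<in> circle X \<and> (line v2, line w2) \<in> circle X
        \<and> (line (v1 + v2), line (w1 + w2)) \<in> circle X" using v w by simp
    qed
  qed
qed

end

theorem theorem6p4:
  fixes q :: nat
    and \<phi> :: "'a::{field,finite} \<Rightarrow> 'a"
    and F :: "('a proj_point \<times> 'a proj_point) set set"
  assumes "primepow q"
    and "CARD('a) = q"
    and "field_automorphism \<phi>"
    and "intersecting_family \<phi> F"
  shows "card F \<le> q * (q - 1) \<and>
    (card F = q * (q - 1) \<longleftrightarrow> (\<exists>p\<in>CM_points. F = {C \<in> CM_circles \<phi>. p \<in> C}))"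
proof -
  interpret twisted_circles \<phi> by standard (rule assms(3))
  interpret minkowski_plane PG1 "CM_circles \<phi>" "int q"
    using minkowski_plane assms(2) by simp
  \<comment> \<open>Since \<open>q\<close> is at least 2, the truncated subtraction of natural
    numbers agrees with that of integers.\<close>
  have eq: "int q * (int q - 1) = int (q * (q - 1))"
    using q_ge_2 by (simp add: of_nat_diff)
  have "F \<subseteq> CM_circles \<phi>" and "C \<inter> D \<noteq> {}" if "C \<in> F" "D \<in> F" for C D
    using assms(4) that by (auto simp: intersecting_family_def)
  then show ?thesis
    using intersecting_family_bound[of F] assms(4)
    unfolding eq of_nat_eq_iff of_nat_le_iff CM_points_def intersecting_family_def by blast
qed

end
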